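(* Let $I$ be an institution with a skolemization $\langle I,S,(\mathcal I_\Sigma)_{\Sigma\in|\mathit{Sig}^I|},(\tau_\Sigma)_{\Sigma\in|\mathit{Sig}^I|}\rangle$, where $S(\Sigma,M)=\langle(\Sigma_S,S_\Sigma),M_{S\Sigma}\rangle$. Let $J$ be an institution and $\langle\phi,\alpha,\beta\rangle:J\to I$ an institution morphism such that: (1) $\phi:\mathit{Sig}^J\to\mathit{Sig}^I$ is fully faithful; (2) for each $\Sigma\in|\mathit{Sig}^J|$ there is $\tilde\Sigma\in|\mathit{Sig}^J|$ and an isomorphism $i_{\phi\Sigma}:\phi(\tilde\Sigma)\to(\phi\Sigma)_S$ in $\mathit{Sig}^I$; (3) each $\beta_\Sigma:\mathit{Mod}^J(\Sigma)\to\mathit{Mod}^I(\phi\Sigma)$ is an isomorphism of categories; (4) each $\alpha_\Sigma$ is semantically surjective, i.e. for every $\varphi\in\mathit{Sen}^J(\Sigma)$ there is $\psi\in\alpha_\Sigma[\mathit{Sen}^I(\phi\Sigma)]$ with $\varphi^*=\psi^*$. Then $J$ has a skolemization $\langle J,S',(\mathcal I'_\Sigma)_{\Sigma\in|\mathit{Sig}^J|},(\tau'_\Sigma)_{\Sigma\in|\mathit{Sig}^J|}\rangle$ in which, for each $\Sigma$: the skolem signature of $\Sigma$ is $\tilde\Sigma$; $\tau'_\Sigma:\Sigma\to\tilde\Sigma$ is the unique arrow with $\phi(\tau'_\Sigma)=i_{\phi\Sigma}^{-1}\circ\tau_{\phi\Sigma}$; and if $\mathcal I_{\phi\Sigma}=\langle\mathcal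 U,\mathcal E\rangle$ then $\mathcal I'_\Sigma=\langle\mathcal U',\mathcal E'\rangle$, where $\mathcal U'$ and $\mathcal E'$ are the images of $\mathcal U$ and $\mathcal E$ under the functor $\beta_{\tilde\Sigma}^{-1}\circ\mathit{Mod}^I(i_{\phi\Sigma}):\mathit{Mod}^I((\phi\Sigma)_S)\to\mathit{Mod}^J(\tilde\Sigma)$.
   Context: An institution $\langle\mathit{Sig},\mathit{Sen},\mathit{Mod},\models\rangle$: a category $\mathit{Sig}$, functors $\mathit{Sen}:\mathit{Sig}\to\mathbf{Set}$, $\mathit{Mod}:\mathit{Sig}^{op}\to\mathbf{Cat}$, and relations $\models_\Sigma\subseteq|\mathit{Mod}(\Sigma)|\times\mathit{Sen}(\Sigma)$ with $M'\models_{\Sigma'}\mathit{Sen}(h)(\phi)$ iff $\mathit{Mod}(h)(M')\models_\Sigma\phi$ for all $h:\Sigma\to\Sigma'$. Write $M\restriction_h=\mathit{Mod}(h)(M)$; for a model $M$, $M^*=\{\varphi: M\models\varphi\}$; for a sentence $\varphi$, $\varphi^*$ is the class of models satisfying it. An institution morphism $\langle\phi,\alpha,\beta\rangle:J\to I$: a functor $\phi:\mathit{Sig}^J\to\mathit{Sig}^I$, natural transformations $\alpha:\mathit{Sen}^I\circ\phi\Rightarrow\mathit{Sen}^J$, $\beta:\mathit{Mod}^J\Rightarrow\mathit{Mod}^I\circ\phi^{op}$, with $m\models^J_\Sigma\alpha_\Sigma(\psi)$ iff $\beta_\Sigma(m)\models^I_{\phi\Sigma}\psi$. The Grothendieck category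 $\mathit{Mod}^\sharp$ has objects $(\Sigma,M)$ with $M\in|\mathit{Mod}(\Sigma)|$ and arrows $(f,u):(\Sigma,M)\to(\Sigma',N)$ with $f:\Sigma\to\Sigma'$ and $u:M\to N\restriction_f$ in $\mathit{Mod}(\Sigma)$, composed by $(g,v)\circ(f,u)=(g\circ f,\mathit{Mod}(f)(v)\circ u)$. $\mathbb{P}res$ is the category of presentations $(\Sigma,E)$, $E\subseteq\mathit{Sen}(\Sigma)$, with arrows $f:\Sigma\to\Sigma'$ such that $\mathit{Sen}(f)(E)\subseteq E'$; $\mathit{Mod}^{\mathbb{P}res}(\Sigma,E)$ is the full subcategory of $\mathit{Mod}(\Sigma)$ of models satisfying all of $E$, with reducts inherited from $\mathit{Mod}$. An inclusion system on a category $\mathcal C$ is a pair $\langle\mathcal U,\mathcal E\rangle$ of broad subcategories of $\mathcal C$ such that $\mathcal U$ is a partial order and every arrow of $\mathcal C$ factors uniquely as an arrow of $\mathcal E$ followed by an arrow of $\mathcal U$; arrows of $\mathcal U$ are written $M\hookrightarrow N$. A skolemization of an institution $I$ is a tuple $\langle I,S,(\mathcal I_\Sigma)_{\Sigma},(\tau_\Sigma)_{\Sigma}\rangle$ where: $S:\mathit{Mod}^\sharp\to(\mathit{Mod}^{\mathbb{P}res})^\sharp$ is a functor sending $(\Sigma,M)$ to $((\Sigma_S,S_\Sigma),M_{S\Sigma})$ (the presentation $(\Sigma_S,S_\Sigma)$ depending only on $\Sigma$); for each $\Sigma$, $\tau_\Sigma:\Sigma\to\Sigma_S$ is an arrow of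 $\mathit{Sig}$ with $M_{S\Sigma}\restriction_{\tau_\Sigma}=M$ for all $M\in|\mathit{Mod}(\Sigma)|$; a $\Sigma_S$-model $M'$ is called a skolemization of the $\Sigma$-model $M$ if $M'\restriction_{\tau_\Sigma}=M$ and $M'\models S_\Sigma$; and $\mathcal I_\Sigma$ is an inclusion system on $\mathit{Mod}(\Sigma_S)$ such that whenever $M',N'$ are skolemizations of $M,N$ respectively and $M'\hookrightarrow N'$, then $M^*=N^*$. *)

theory Defs
  imports Main "HOL-Library.FuncSet"
begin

section \<open>Categories and functors\<close>

record ('o, 'a) cat =
  Obj :: "'o set"
  Arr :: "'a set"
  Src :: "'a \<Rightarrow> 'o"
  Tgt :: "'a \<Rightarrow> 'o"
  Idn :: "'o \<Rightarrow> 'a"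
  Cmp :: "'a \<Rightarrow> 'a \<Rightarrow> 'a"

text \<open>\<open>Cmp C g f\<close> is \<open>g \<circ> f\<close>. All functions are only constrained on \<open>Obj C\<close>, \<open>Arr C\<close> and on
  composable pairs.\<close>

locale category =
  fixes C :: "('o, 'a) cat"
  assumes src_obj: "f \<in> Arr C \<Longrightarrow> Src C f \<in> Obj C"
    and tgt_obj: "f \<in> Arr C \<Longrightarrow> Tgt C f \<in> Obj C"
    and idn_arr: "x \<in> Obj C \<Longrightarrow> Idn C x \<in> Arr C"
    and src_idn: "x \<in> Obj C \<Longrightarrow> Src C (Idn C x) = x"
    and tgt_idn: "x \<in> Obj C \<Longrightarrow> Tgt C (Idn C x) = x"
    and cmp_arr: "\<lbrakk>f \<in> Arr C; g \<in> Arr C; Tgt C f = Src C g\<rbrakk> \<Longrightarrow> Cmp C g f \<in> Arr C"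
    and src_cmp: "\<lbrakk>f \<in> Arr C; g \<in> Arr C; Tgt C f = Src C g\<rbrakk> \<Longrightarrow> Src C (Cmp C g f) = Src C f"
    and tgt_cmp: "\<lbrakk>f \<in> Arr C; g \<in> Arr C; Tgt C f = Src C g\<rbrakk> \<Longrightarrow> Tgt C (Cmp C g f) = Tgt C g"
    and cmp_idn_right: "f \<in> Arr C \<Longrightarrow> Cmp C f (Idn C (Src C f)) = f"
    and cmp_idn_left: "f \<in> Arr C \<Longrightarrow> Cmp C (Idn C (Tgt C f)) f = f"
    and cmp_assoc: "\<lbrakk>f \<in> Arr C; g \<in> Arr C; h \<in> Arr C; Tgt C f = Src C g; Tgt C g = Src C h\<rbrakk>
        \<Longrightarrow> Cmp C h (Cmp C g f) = Cmp C (Cmp C h g) f"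

definition hom_set :: "('o, 'a) cat \<Rightarrow> 'o \<Rightarrow> 'o \<Rightarrow> 'a set" where
  "hom_set C x y = {f \<in> Arr C. Src C f = x \<and> Tgt C f = y}"

definition inverse_arrows :: "('o, 'a) cat \<Rightarrow> 'a \<Rightarrow> 'a \<Rightarrow> bool" where
  "inverse_arrows C f g \<longleftrightarrow>
     f \<in> Arr C \<and> g \<in> hom_set C (Tgt C f) (Src C f) \<and>
     Cmp C g f = Idn C (Src C f) \<and> Cmp C f g = Idn C (Tgt C f)"

definition iso_arrow :: "('o, 'a) cat \<Rightarrow> 'a \<Rightarrow> bool" where
  "iso_arrow C f \<longleftrightarrow> (\<exists>g. inverse_arrows C f g)"

definition inv_arrow :: "('o, 'a) cat \<Rightarrow> 'a \<Rightarrow> 'a" where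
  "inv_arrow C f = (THE g. inverse_arrows C f g)"

definition full_subcat :: "('o, 'a) cat \<Rightarrow> ('o \<Rightarrow> bool) \<Rightarrow> ('o, 'a) cat" where
  "full_subcat C P =
     C\<lparr>Obj := {x \<in> Obj C. P x}, Arr := {f \<in> Arr C. P (Src C f) \<and> P (Tgt C f)}\<rparr>"

record ('o1, 'a1, 'o2, 'a2) fnctr =
  FOb :: "'o1 \<Rightarrow> 'o2"
  FAr :: "'a1 \<Rightarrow> 'a2"

locale is_functor = src: category C + tgt: category D
  for C :: "('o1, 'a1) cat" and D :: "('o2, 'a2) cat" +
  fixes F :: "('o1, 'a1, 'o2, 'a2) fnctr"
  assumes ob: "x \<in> Obj C \<Longrightarrow> FOb F x \<in> Obj D"
    and ar: "f \<in> Arr C \<Longrightarrow> FAr F f \<in> Arr D"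
    and src: "f \<in> Arr C \<Longrightarrow> Src D (FAr F f) = FOb F (Src C f)"
    and tgt: "f \<in> Arr C \<Longrightarrow> Tgt D (FAr F f) = FOb F (Tgt C f)"
    and idn: "x \<in> Obj C \<Longrightarrow> FAr F (Idn C x) = Idn D (FOb F x)"
    and cmp: "\<lbrakk>f \<in> Arr C; g \<in> Arr C; Tgt C f = Src C g\<rbrakk>
        \<Longrightarrow> FAr F (Cmp C g f) = Cmp D (FAr F g) (FAr F f)"

definition functor_comp ::
  "('o2, 'a2, 'o3, 'a3) fnctr \<Rightarrow> ('o1, 'a1, 'o2, 'a2) fnctr \<Rightarrow> ('o1, 'a1, 'o3, 'a3) fnctr" where
  "functor_comp G F = \<lparr>FOb = FOb G \<circ> FOb F, FAr = FAr G \<circ> FAr F\<rparr>"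

definition fully_faithful ::
  "('o1, 'a1) cat \<Rightarrow> ('o2, 'a2) cat \<Rightarrow> ('o1, 'a1, 'o2, 'a2) fnctr \<Rightarrow> bool" where
  "fully_faithful C D F \<longleftrightarrow>
     (\<forall>x\<in>Obj C. \<forall>y\<in>Obj C. bij_betw (FAr F) (hom_set C x y) (hom_set D (FOb F x) (FOb F y)))"

definition inverse_functors ::
  "('o1, 'a1) cat \<Rightarrow> ('o2, 'a2) cat \<Rightarrow> ('o1, 'a1, 'o2, 'a2) fnctr
    \<Rightarrow> ('o2, 'a2, 'o1, 'a1) fnctr \<Rightarrow> bool" where
  "inverse_functors C D F G \<longleftrightarrow>
     is_functor C D F \<and> is_functor D C G \<and>
     (\<forall>x\<in>Obj C. FOb G (FOb F x) = x) \<and> (\<forall>f\<in>Arr C. FAr G (FAr F f) = f) \<and>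
     (\<forall>y\<in>Obj D. FOb F (FOb G y) = y) \<and> (\<forall>g\<in>Arr D. FAr F (FAr G g) = g)"

definition iso_of_categories ::
  "('o1, 'a1) cat \<Rightarrow> ('o2, 'a2) cat \<Rightarrow> ('o1, 'a1, 'o2, 'a2) fnctr \<Rightarrow> bool" where
  "iso_of_categories C D F \<longleftrightarrow> (\<exists>G. inverse_functors C D F G)"

definition inv_functor ::
  "('o1, 'a1) cat \<Rightarrow> ('o1, 'a1, 'o2, 'a2) fnctr \<Rightarrow> ('o2, 'a2, 'o1, 'a1) fnctr" where
  "inv_functor C F = \<lparr>FOb = inv_into (Obj C) (FOb F), FAr = inv_into (Arr C) (FAr F)\<rparr>"


section \<open>Functors into \<open>Cat\<close> and the Grothendieck construction\<close>

record ('o, 'a, 'm, 'u) indexed =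
  Fib :: "'o \<Rightarrow> ('m, 'u) cat"
  Red :: "'a \<Rightarrow> ('m, 'u, 'm, 'u) fnctr"

text \<open>A functor from the opposite of \<open>B\<close> to \<open>Cat\<close>; equality of functors is equality on the
  objects and arrows of the source category.\<close>

locale indexed_category = base: category B
  for B :: "('o, 'a) cat" +
  fixes X :: "('o, 'a, 'm, 'u) indexed"
  assumes fib: "x \<in> Obj B \<Longrightarrow> category (Fib X x)"
    and red: "f \<in> Arr B \<Longrightarrow> is_functor (Fib X (Tgt B f)) (Fib X (Src B f)) (Red X f)"
    and red_idn_ob: "\<lbrakk>x \<in> Obj B; m \<in> Obj (Fib X x)\<rbrakk> \<Longrightarrow> FOb (Red X (Idn B x)) m = m"
    and red_idn_ar: "\<lbrakk>x \<in> Obj B; u \<in> Arr (Fib X x)\<rbrakk> \<Longrightarrow> FAr (Red X (Idn B x)) u = u"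
    and red_cmp_ob: "\<lbrakk>f \<in> Arr B; g \<in> Arr B; Tgt B f = Src B g; m \<in> Obj (Fib X (Tgt B g))\<rbrakk>
        \<Longrightarrow> FOb (Red X (Cmp B g f)) m = FOb (Red X f) (FOb (Red X g) m)"
    and red_cmp_ar: "\<lbrakk>f \<in> Arr B; g \<in> Arr B; Tgt B f = Src B g; u \<in> Arr (Fib X (Tgt B g))\<rbrakk>
        \<Longrightarrow> FAr (Red X (Cmp B g f)) u = FAr (Red X f) (FAr (Red X g) u)"

text \<open>An arrow \<open>(f, u)\<close> is stored together with its source and its target, since \<open>f\<close> and \<open>u\<close>
  determine only the reduct of the target model.\<close>

definition grothendieck ::
  "('o, 'a) cat \<Rightarrow> ('o, 'a, 'm, 'u) indexed
    \<Rightarrow> ('o \<times> 'm, ('o \<times> 'm) \<times> ('a \<times> 'u) \<times> ('o \<times> 'm)) cat" where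
  "grothendieck B X = \<lparr>
     Obj = {(x, m). x \<in> Obj B \<and> m \<in> Obj (Fib X x)},
     Arr = {((x, m), (f, u), (y, n)).
              m \<in> Obj (Fib X x) \<and> n \<in> Obj (Fib X y) \<and>
              f \<in> hom_set B x y \<and> u \<in> hom_set (Fib X x) m (FOb (Red X f) n)},
     Src = (\<lambda>(p, _, _). p),
     Tgt = (\<lambda>(_, _, q). q),
     Idn = (\<lambda>(x, m). ((x, m), (Idn B x, Idn (Fib X x) m), (x, m))),
     Cmp = (\<lambda>(_, (g, v), r) ((x, m), (f, u), _).
              ((x, m), (Cmp B g f, Cmp (Fib X x) (FAr (Red X f) v) u), r))\<rparr>"


section \<open>Institutions\<close>

text \<open>Signatures, sentences, models and model homomorphisms are drawn from the types \<open>'o\<close>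
  (arrows from \<open>'a\<close>), \<open>'s\<close>, \<open>'m\<close> and \<open>'u\<close>.\<close>

record ('o, 'a, 's, 'm, 'u) institution =
  Sig :: "('o, 'a) cat"
  Sen :: "'o \<Rightarrow> 's set"
  SenMap :: "'a \<Rightarrow> 's \<Rightarrow> 's"
  Mod :: "('o, 'a, 'm, 'u) indexed"
  Sat :: "'o \<Rightarrow> 'm \<Rightarrow> 's \<Rightarrow> bool"

abbreviation Models :: "('o, 'a, 's, 'm, 'u) institution \<Rightarrow> 'o \<Rightarrow> ('m, 'u) cat" where
  "Models I x \<equiv> Fib (Mod I) x"

abbreviation reduct :: "('o, 'a, 's, 'm, 'u) institution \<Rightarrow> 'a \<Rightarrow> 'm \<Rightarrow> 'm" where
  "reduct I h \<equiv> FOb (Red (Mod I) h)"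

locale is_institution = indexed_category "Sig I" "Mod I"
  for I :: "('o, 'a, 's, 'm, 'u) institution" +
  assumes sen_map: "h \<in> Arr (Sig I)
        \<Longrightarrow> SenMap I h \<in> Sen I (Src (Sig I) h) \<rightarrow> Sen I (Tgt (Sig I) h)"
    and sen_idn: "\<lbrakk>x \<in> Obj (Sig I); \<phi> \<in> Sen I x\<rbrakk> \<Longrightarrow> SenMap I (Idn (Sig I) x) \<phi> = \<phi>"
    and sen_cmp: "\<lbrakk>f \<in> Arr (Sig I); g \<in> Arr (Sig I); Tgt (Sig I) f = Src (Sig I) g;
          \<phi> \<in> Sen I (Src (Sig I) f)\<rbrakk>
        \<Longrightarrow> SenMap I (Cmp (Sig I) g f) \<phi> = SenMap I g (SenMap I f \<phi>)"
    and satisfaction: "\<lbrakk>h \<in> hom_set (Sig I) x y; m \<in> Obj (Models I y); \<phi> \<in> Sen I x\<rbrakk>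
        \<Longrightarrow> Sat I y m (SenMap I h \<phi>) \<longleftrightarrow> Sat I x (reduct I h m) \<phi>"

definition model_star :: "('o, 'a, 's, 'm, 'u) institution \<Rightarrow> 'o \<Rightarrow> 'm \<Rightarrow> 's set" where
  "model_star I x m = {\<phi> \<in> Sen I x. Sat I x m \<phi>}"

definition sentence_star :: "('o, 'a, 's, 'm, 'u) institution \<Rightarrow> 'o \<Rightarrow> 's \<Rightarrow> 'm set" where
  "sentence_star I x \<phi> = {m \<in> Obj (Models I x). Sat I x m \<phi>}"

locale institution_morphism =
  J: is_institution J + I: is_institution I + sig: is_functor "Sig J" "Sig I" \<phi>
  for J :: "('o2, 'a2, 's2, 'm2, 'u2) institution"
    and I :: "('o1, 'a1, 's1, 'm1, 'u1) institution"
    and \<phi> :: "('o2, 'a2, 'o1, 'a1) fnctr" +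
  fixes \<alpha> :: "'o2 \<Rightarrow> 's1 \<Rightarrow> 's2"
    and \<beta> :: "'o2 \<Rightarrow> ('m2, 'u2, 'm1, 'u1) fnctr"
  assumes sen: "x \<in> Obj (Sig J) \<Longrightarrow> \<alpha> x \<in> Sen I (FOb \<phi> x) \<rightarrow> Sen J x"
    and sen_natural: "\<lbrakk>h \<in> hom_set (Sig J) x y; \<psi> \<in> Sen I (FOb \<phi> x)\<rbrakk>
        \<Longrightarrow> \<alpha> y (SenMap I (FAr \<phi> h) \<psi>) = SenMap J h (\<alpha> x \<psi>)"
    and mod: "x \<in> Obj (Sig J) \<Longrightarrow> is_functor (Models J x) (Models I (FOb \<phi> x)) (\<beta> x)"
    and mod_natural_ob: "\<lbrakk>h \<in> hom_set (Sig J) x y; m \<in> Obj (Models J y)\<rbrakk>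
        \<Longrightarrow> FOb (\<beta> x) (FOb (Red (Mod J) h) m) = FOb (Red (Mod I) (FAr \<phi> h)) (FOb (\<beta> y) m)"
    and mod_natural_ar: "\<lbrakk>h \<in> hom_set (Sig J) x y; u \<in> Arr (Models J y)\<rbrakk>
        \<Longrightarrow> FAr (\<beta> x) (FAr (Red (Mod J) h) u) = FAr (Red (Mod I) (FAr \<phi> h)) (FAr (\<beta> y) u)"
    and sat: "\<lbrakk>x \<in> Obj (Sig J); m \<in> Obj (Models J x); \<psi> \<in> Sen I (FOb \<phi> x)\<rbrakk>
        \<Longrightarrow> Sat J x m (\<alpha> x \<psi>) \<longleftrightarrow> Sat I (FOb \<phi> x) (FOb (\<beta> x) m) \<psi>"

definition semantically_surjective ::
  "('o, 'a, 's, 'm, 'u) institution \<Rightarrow> 'o \<Rightarrow> 't set \<Rightarrow> ('t \<Rightarrow> 's) \<Rightarrow> bool" where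
  "semantically_surjective J x T a \<longleftrightarrow>
     (\<forall>\<phi>\<in>Sen J x. \<exists>\<psi>\<in>a ` T. sentence_star J x \<phi> = sentence_star J x \<psi>)"


section \<open>Presentations\<close>

definition satisfies_all :: "('o, 'a, 's, 'm, 'u) institution \<Rightarrow> 'o \<times> 's set \<Rightarrow> 'm \<Rightarrow> bool" where
  "satisfies_all I P m \<longleftrightarrow> (\<forall>\<phi>\<in>snd P. Sat I (fst P) m \<phi>)"

definition Pres ::
  "('o, 'a, 's, 'm, 'u) institution
    \<Rightarrow> ('o \<times> 's set, ('o \<times> 's set) \<times> 'a \<times> ('o \<times> 's set)) cat" where
  "Pres I = \<lparr>
     Obj = {(x, E). x \<in> Obj (Sig I) \<and> E \<subseteq> Sen I x},
     Arr = {((x, E), f, (y, E')).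
              E \<subseteq> Sen I x \<and> E' \<subseteq> Sen I y \<and> f \<in> hom_set (Sig I) x y \<and> SenMap I f ` E \<subseteq> E'},
     Src = (\<lambda>(p, _, _). p),
     Tgt = (\<lambda>(_, _, q). q),
     Idn = (\<lambda>p. (p, Idn (Sig I) (fst p), p)),
     Cmp = (\<lambda>(_, g, r) (p, f, _). (p, Cmp (Sig I) g f, r))\<rparr>"

definition ModPres ::
  "('o, 'a, 's, 'm, 'u) institution
    \<Rightarrow> ('o \<times> 's set, ('o \<times> 's set) \<times> 'a \<times> ('o \<times> 's set), 'm, 'u) indexed" where
  "ModPres I = \<lparr>
     Fib = (\<lambda>P. full_subcat (Models I (fst P)) (satisfies_all I P)),
     Red = (\<lambda>(_, f, _). Red (Mod I) f)\<rparr>"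


section \<open>Inclusion systems and skolemizations\<close>

text \<open>A broad subcategory is given by its set of arrows.\<close>

definition broad_subcategory :: "('o, 'a) cat \<Rightarrow> 'a set \<Rightarrow> bool" where
  "broad_subcategory C U \<longleftrightarrow>
     U \<subseteq> Arr C \<and> (\<forall>x\<in>Obj C. Idn C x \<in> U) \<and>
     (\<forall>f\<in>U. \<forall>g\<in>U. Tgt C f = Src C g \<longrightarrow> Cmp C g f \<in> U)"

definition partial_order_arrows :: "('o, 'a) cat \<Rightarrow> 'a set \<Rightarrow> bool" where
  "partial_order_arrows C U \<longleftrightarrow>
     (\<forall>f\<in>U. \<forall>g\<in>U. Src C f = Src C g \<and> Tgt C f = Tgt C g \<longrightarrow> f = g) \<and>
     (\<forall>f\<in>U. \<forall>g\<in>U. Src C f = Tgt C g \<and> Tgt C f = Src C g \<longrightarrow> Src C f = Tgt C f)"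

definition inclusion_system :: "('o, 'a) cat \<Rightarrow> 'a set \<times> 'a set \<Rightarrow> bool" where
  "inclusion_system C = (\<lambda>(U, E).
     broad_subcategory C U \<and> broad_subcategory C E \<and> partial_order_arrows C U \<and>
     (\<forall>f\<in>Arr C. \<exists>!(e, i). e \<in> E \<and> i \<in> U \<and> Tgt C e = Src C i \<and> Cmp C i e = f))"

definition inclusion :: "('o, 'a) cat \<Rightarrow> 'a set \<times> 'a set \<Rightarrow> 'o \<Rightarrow> 'o \<Rightarrow> bool" where
  "inclusion C UE m n \<longleftrightarrow> (\<exists>u\<in>fst UE. Src C u = m \<and> Tgt C u = n)"

text \<open>The assignment of the presentation \<open>(\<Sigma>\<^sub>S, S\<^sub>\<Sigma>)\<close> to \<open>\<Sigma>\<close> is a component of its own, because the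
  functor does not determine it on signatures without models.\<close>

record ('o, 'a, 's, 'm, 'u) skolem =
  SkFun :: "('o \<times> 'm, ('o \<times> 'm) \<times> ('a \<times> 'u) \<times> ('o \<times> 'm),
             ('o \<times> 's set) \<times> 'm,
             (('o \<times> 's set) \<times> 'm) \<times> ((('o \<times> 's set) \<times> 'a \<times> ('o \<times> 's set)) \<times> 'u)
               \<times> (('o \<times> 's set) \<times> 'm)) fnctr"
  SkPres :: "'o \<Rightarrow> 'o \<times> 's set"
  SkIncl :: "'o \<Rightarrow> 'u set \<times> 'u set"
  SkTau :: "'o \<Rightarrow> 'a"

definition SkSig :: "('o, 'a, 's, 'm, 'u) skolem \<Rightarrow> 'o \<Rightarrow> 'o" where
  "SkSig K x = fst (SkPres K x)"

definition SkMod :: "('o, 'a, 's, 'm, 'u) skolem \<Rightarrow> 'o \<Rightarrow> 'm \<Rightarrow> 'm" where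
  "SkMod K x m = snd (FOb (SkFun K) (x, m))"

definition skolemization_of ::
  "('o, 'a, 's, 'm, 'u) institution \<Rightarrow> ('o, 'a, 's, 'm, 'u) skolem \<Rightarrow> 'o \<Rightarrow> 'm \<Rightarrow> 'm \<Rightarrow> bool" where
  "skolemization_of I K x m' m \<longleftrightarrow>
     m' \<in> Obj (Models I (SkSig K x)) \<and> reduct I (SkTau K x) m' = m \<and>
     satisfies_all I (SkPres K x) m'"

locale skolemization = is_institution I
  for I :: "('o, 'a, 's, 'm, 'u) institution" +
  fixes K :: "('o, 'a, 's, 'm, 'u) skolem"
  assumes sk_functor:
      "is_functor (grothendieck (Sig I) (Mod I)) (grothendieck (Pres I) (ModPres I)) (SkFun K)"
    and sk_pres: "x \<in> Obj (Sig I) \<Longrightarrow> SkPres K x \<in> Obj (Pres I)"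
    and sk_functor_pres: "\<lbrakk>x \<in> Obj (Sig I); m \<in> Obj (Models I x)\<rbrakk>
        \<Longrightarrow> fst (FOb (SkFun K) (x, m)) = SkPres K x"
    and sk_tau: "x \<in> Obj (Sig I) \<Longrightarrow> SkTau K x \<in> hom_set (Sig I) x (SkSig K x)"
    and sk_reduct: "\<lbrakk>x \<in> Obj (Sig I); m \<in> Obj (Models I x)\<rbrakk>
        \<Longrightarrow> reduct I (SkTau K x) (SkMod K x m) = m"
    and sk_inclusion_system: "x \<in> Obj (Sig I)
        \<Longrightarrow> inclusion_system (Models I (SkSig K x)) (SkIncl K x)"
    and sk_elementary: "\<lbrakk>x \<in> Obj (Sig I); m \<in> Obj (Models I x); n \<in> Obj (Models I x);
          skolemization_of I K x m' m; skolemization_of I K x n' n;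
          inclusion (Models I (SkSig K x)) (SkIncl K x) m' n'\<rbrakk>
        \<Longrightarrow> model_star I x m = model_star I x n"


section \<open>Well-definedness of the constructions\<close>

lemma (in category) inverse_arrows_unique:
  assumes "inverse_arrows C f g" "inverse_arrows C f h" shows "g = h"
  using assms unfolding inverse_arrows_def hom_set_def
  by (smt (verit, ccfv_threshold) mem_Collect_eq cmp_assoc cmp_idn_left cmp_idn_right)

lemma (in category) inv_arrow: "iso_arrow C f \<Longrightarrow> inverse_arrows C f (inv_arrow C f)"
  unfolding iso_arrow_def inv_arrow_def by (metis inverse_arrows_unique theI)

lemma inv_functor:
  assumes "inverse_functors C D F G"
  shows "\<And>y. y \<in> Obj D \<Longrightarrow> FOb (inv_functor C F) y = FOb G y"
    "\<And>g. g \<in> Arr D \<Longrightarrow> FAr (inv_functor C F) g = FAr G g"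
proof -
  interpret F: is_functor C D F using assms by (simp add: inverse_functors_def)
  interpret G: is_functor D C G using assms by (simp add: inverse_functors_def)
  have "inj_on (FOb F) (Obj C)" "inj_on (FAr F) (Arr C)"
    using assms by (auto simp: inverse_functors_def intro: inj_on_inverseI)
  then show "\<And>y. y \<in> Obj D \<Longrightarrow> FOb (inv_functor C F) y = FOb G y"
    "\<And>g. g \<in> Arr D \<Longrightarrow> FAr (inv_functor C F) g = FAr G g"
    using assms G.ob G.ar unfolding inverse_functors_def inv_functor_def
    by (simp_all, (metis inv_into_f_f)+)
qed

lemma category_full_subcat:
  assumes "category C" shows "category (full_subcat C P)"
proof -
  interpret category C by fact
  show ?thesis
    by unfold_locales (auto simp: full_subcat_def src_obj tgt_obj idn_arr src_idn tgt_idn cmp_arr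
        src_cmp tgt_cmp cmp_idn_right cmp_idn_left cmp_assoc)
qed

lemma (in indexed_category) category_grothendieck: "category (grothendieck B X)"
proof -
  note fc = fib[THEN category.src_obj] fib[THEN category.tgt_obj] fib[THEN category.idn_arr]
    fib[THEN category.src_idn] fib[THEN category.tgt_idn] fib[THEN category.cmp_arr]
    fib[THEN category.src_cmp] fib[THEN category.tgt_cmp]
    fib[THEN category.cmp_idn_right] fib[THEN category.cmp_idn_left] fib[THEN category.cmp_assoc]
  note rc = red[THEN is_functor.ob] red[THEN is_functor.ar] red[THEN is_functor.src]
    red[THEN is_functor.tgt] red[THEN is_functor.idn] red[THEN is_functor.cmp]
  note bc = base.src_obj base.tgt_obj base.idn_arr base.src_idn base.tgt_idn base.cmp_arr
    base.src_cmp base.tgt_cmp base.cmp_idn_right base.cmp_idn_left base.cmp_assoc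
  note xc = red_idn_ob red_idn_ar red_cmp_ob red_cmp_ar
  have cmp_cmp: "Cmp (Fib X (Src B f)) (FAr (Red X (Cmp B g f)) w) (Cmp (Fib X (Src B f)) (FAr (Red X f) v) u)
     = Cmp (Fib X (Src B f)) (FAr (Red X f) (Cmp (Fib X (Src B g)) (FAr (Red X g) w) v)) u"
    if fg: "f \<in> Arr B" "g \<in> Arr B" "Tgt B f = Src B g" "w \<in> Arr (Fib X (Tgt B g))"
      "v \<in> Arr (Fib X (Src B g))" "u \<in> Arr (Fib X (Src B f))"
      "Tgt (Fib X (Src B f)) u = FOb (Red X f) (Src (Fib X (Src B g)) v)"
      "Tgt (Fib X (Src B g)) v = FOb (Red X g) (Src (Fib X (Tgt B g)) w)" for f g u v w
  proof -
    interpret f: is_functor "Fib X (Src B g)" "Fib X (Src B f)" "Red X f" using red[of f] fg by simp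
    interpret g: is_functor "Fib X (Tgt B g)" "Fib X (Src B g)" "Red X g" using red[of g] fg by simp
    show ?thesis using fg
      by (simp add: red_cmp_ar f.cmp g.ar g.src f.ar f.src f.tgt f.tgt.cmp_assoc)
  qed
  show ?thesis
    apply unfold_locales
              apply (auto simp: grothendieck_def hom_set_def bc fc rc xc)[8]
    subgoal apply (auto simp: grothendieck_def hom_set_def bc fc rc xc) done
    subgoal apply (auto simp: grothendieck_def hom_set_def bc fc rc xc) by (metis base.src_obj fc(10))
    subgoal by (auto simp: grothendieck_def hom_set_def bc intro!: cmp_cmp)
    done
qed

lemma (in is_institution) category_Pres: "category (Pres I)"
  using sen_map
  apply unfold_locales
  apply (auto simp: Pres_def hom_set_def base.src_obj base.tgt_obj base.idn_arr base.src_idn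
    base.tgt_idn base.cmp_arr base.src_cmp base.tgt_cmp base.cmp_idn_right base.cmp_idn_left
    base.cmp_assoc subset_iff sen_idn sen_cmp image_subset_iff)
  done

lemma (in is_institution) indexed_category_ModPres: "indexed_category (Pres I) (ModPres I)"
proof -
  interpret P: category "Pres I" by (rule category_Pres)
  show ?thesis
  proof (intro indexed_category.intro P.category_axioms indexed_category_axioms.intro)
    fix x assume "x \<in> Obj (Pres I)"
    then show "category (Fib (ModPres I) x)"
      by (auto simp: ModPres_def Pres_def intro!: category_full_subcat fib)
  next
    fix f assume f: "f \<in> Arr (Pres I)"
    then obtain x E h y E' where h: "f = ((x,E),h,(y,E'))" "E \<subseteq> Sen I x" "E' \<subseteq> Sen I y"
      "h \<in> hom_set (Sig I) x y" "SenMap I h ` E \<subseteq> E'" by (auto simp: Pres_def)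
    then have h': "h \<in> Arr (Sig I)" "Src (Sig I) h = x" "Tgt (Sig I) h = y"
      by (auto simp: hom_set_def)
    interpret R: is_functor "Models I y" "Models I x" "Red (Mod I) h" using red[OF h'(1)] h' by simp
    have sat: "satisfies_all I (x,E) (reduct I h m)"
      if "m \<in> Obj (Models I y)" "satisfies_all I (y,E') m" for m
      using that h(2,3,5) satisfaction[OF h(4)] unfolding satisfies_all_def
      by (simp add: image_subset_iff) blast
    have "is_functor (full_subcat (Models I y) (satisfies_all I (y,E')))
       (full_subcat (Models I x) (satisfies_all I (x,E))) (Red (Mod I) h)"
      apply (intro is_functor.intro category_full_subcat R.src.category_axioms R.tgt.category_axioms)
      apply unfold_locales
      apply (auto simp: full_subcat_def sat R.ob R.ar R.src R.tgt R.idn R.cmp R.src.src_obj R.src.tgt_obj)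
      done
    then show "is_functor (Fib (ModPres I) (Tgt (Pres I) f)) (Fib (ModPres I) (Src (Pres I) f))
            (Red (ModPres I) f)"
      by (simp add: h(1) Pres_def ModPres_def)
  qed (auto simp: Pres_def ModPres_def full_subcat_def hom_set_def red_idn_ob red_idn_ar red_cmp_ob red_cmp_ar)
qed

end

theory Submission
  imports Defs
begin

text \<open>
  Write \<open>j\<close> for the inverse of \<open>i\<close>. Over each \<open>\<Sigma>\<close>, the functor \<open>T = \<beta>\<inverse> \<circ> Mod(i)\<close> is an
  isomorphism from
  the models of \<open>(\<phi>\<Sigma>)\<^sub>S\<close> to those of \<open>til \<Sigma>\<close>, with inverse \<open>G = Mod(j) \<circ> \<beta>\<close>. The Skolem axioms of \<open>\<Sigma>\<close> are
  the sentences \<open>\<alpha>(Sen(j)(s))\<close> for \<open>s\<close> a Skolem axiom of \<open>\<phi>\<Sigma>\<close>; a model \<open>m\<close> satisfies them iff \<open>G m\<close>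
  satisfies the axioms of \<open>\<phi>\<Sigma>\<close>. The new Skolem functor applies \<open>(\<phi>, \<beta>)\<close>, then the given one, then \<open>T\<close>;
  a signature arrow \<open>g\<close> between Skolem signatures is pulled back to the arrow over \<open>j \<circ> g \<circ> i\<close>, which
  exists and is unique as \<open>\<phi>\<close> is fully faithful, and \<open>T\<close> is natural with respect to this assignment.
  If \<open>m'\<close> is a skolemization of \<open>m\<close> then \<open>G m'\<close> is one of \<open>\<beta> m\<close>, so inclusions give \<open>(\<beta> m)\<^sup>* = (\<beta> n)\<^sup>*\<close>,
  and semantic surjectivity of \<open>\<alpha>\<close> turns this into \<open>m\<^sup>* = n\<^sup>*\<close>.
\<close>

section \<open>Functors and inclusion systems\<close>

lemma is_functor_functor_comp:
  assumes "is_functor C D F" "is_functor D E G"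
  shows "is_functor C E (functor_comp G F)"
proof -
  interpret F: is_functor C D F by fact
  interpret G: is_functor D E G by fact
  show ?thesis
    by unfold_locales (simp_all add: functor_comp_def F.ob F.ar F.src F.tgt F.idn F.cmp
        G.ob G.ar G.src G.tgt G.idn G.cmp)
qed

text \<open>The functor laws mention \<open>F\<close> only on the objects and arrows of
  \<open>C\<close>, so values elsewhere are irrelevant. This matters for \<open>inv_functor\<close>,
  which agrees with a given inverse only on the category itself.\<close>

lemma is_functor_cong:
  assumes "is_functor C D F"
    and "\<And>x. x \<in> Obj C \<Longrightarrow> FOb G x = FOb F x" "\<And>f. f \<in> Arr C \<Longrightarrow> FAr G f = FAr F f"
  shows "is_functor C D G"
proof -
  interpret F: is_functor C D F by fact
  show ?thesis
    by unfold_locales (simp_all add: assms(2,3) F.ob F.ar F.src F.tgt F.idn F.cmp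
        F.src.src_obj F.src.tgt_obj F.src.idn_arr F.src.cmp_arr)
qed

lemma inverse_functors_sym: "inverse_functors C D F G \<Longrightarrow> inverse_functors D C G F"
  by (simp add: inverse_functors_def)

lemma inverse_functors_comp:
  assumes "inverse_functors C D F G" "inverse_functors D E F' G'"
  shows "inverse_functors C E (functor_comp F' F) (functor_comp G G')"
proof -
  have f: "is_functor C D F" "is_functor D C G" "is_functor D E F'" "is_functor E D G'"
    using assms by (auto simp: inverse_functors_def)
  note eqs = assms[unfolded inverse_functors_def]
  show ?thesis
    unfolding inverse_functors_def
    using is_functor_functor_comp[OF f(1,3)] is_functor_functor_comp[OF f(4,2)]
      is_functor.ob[OF f(1)] is_functor.ar[OF f(1)] is_functor.ob[OF f(4)] is_functor.ar[OF f(4)]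
      eqs
    by (intro conjI ballI) (simp_all add: functor_comp_def)
qed

text \<open>\<open>iso_of_categories\<close> provides some inverse, and \<open>inv_functor\<close>
  agrees with it on objects and arrows. This makes available the particular inverse that the theorem
  names.\<close>

lemma inverse_functors_inv_functor:
  assumes "iso_of_categories C D F"
  shows "inverse_functors C D F (inv_functor C F)"
proof -
  obtain G where G: "inverse_functors C D F G"
    using assms by (auto simp: iso_of_categories_def)
  then interpret F: is_functor C D F by (simp add: inverse_functors_def)
  have "is_functor D C (inv_functor C F)"
    using G inv_functor[OF G] is_functor_cong unfolding inverse_functors_def by blast
  then show ?thesis
    using G by (simp add: inverse_functors_def inv_functor[OF G] F.ob F.ar)
qed

text \<open>Functors preserve isomorphisms. By contravariance, \<open>Cmp B f g\<close> being an
  identity says that \<open>Red X g\<close> after \<open>Red X f\<close> is the identity on the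
  fibre over the target of \<open>f\<close>.\<close>

lemma (in indexed_category) inverse_functors_Red:
  assumes "inverse_arrows B f g"
  shows "inverse_functors (Fib X (Tgt B f)) (Fib X (Src B f)) (Red X f) (Red X g)"
proof -
  have fg: "f \<in> Arr B" "g \<in> Arr B" "Src B g = Tgt B f" "Tgt B g = Src B f"
      "Cmp B g f = Idn B (Src B f)" "Cmp B f g = Idn B (Tgt B f)"
    using assms by (auto simp: inverse_arrows_def hom_set_def)
  show ?thesis
    unfolding inverse_functors_def
    using red[OF fg(1)] red[OF fg(2)] fg
      red_cmp_ob[of f g] red_cmp_ob[of g f] red_cmp_ar[of f g] red_cmp_ar[of g f]
    by (simp add: red_idn_ob red_idn_ar base.src_obj base.tgt_obj)
qed

section \<open>Transport of inclusion systems along an isomorphism of categories\<close>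

locale functor_inverse =
  fixes C :: "('o1, 'a1) cat" and D :: "('o2, 'a2) cat" and F G
  assumes inverse: "inverse_functors C D F G"
begin

sublocale F: is_functor C D F using inverse by (simp add: inverse_functors_def)
sublocale G: is_functor D C G using inverse by (simp add: inverse_functors_def)

lemma GF_ob: "x \<in> Obj C \<Longrightarrow> FOb G (FOb F x) = x"
  and GF_ar: "f \<in> Arr C \<Longrightarrow> FAr G (FAr F f) = f"
  and FG_ob: "y \<in> Obj D \<Longrightarrow> FOb F (FOb G y) = y"
  and FG_ar: "g \<in> Arr D \<Longrightarrow> FAr F (FAr G g) = g"
  using inverse by (simp_all add: inverse_functors_def)

lemma FOb_eq_iff: "\<lbrakk>x \<in> Obj C; y \<in> Obj C\<rbrakk> \<Longrightarrow> FOb F x = FOb F y \<longleftrightarrow> x = y"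
  by (metis GF_ob)

text \<open>The image of a subcategory under a functor need not be closed under composition, since
  composable images may come from arrows that are not composable. Injectivity of \<open>F\<close> on
  objects excludes this.\<close>

lemma broad_subcategory_image:
  assumes "broad_subcategory C U" shows "broad_subcategory D (FAr F ` U)"
proof -
  have U: "U \<subseteq> Arr C" "\<And>x. x \<in> Obj C \<Longrightarrow> Idn C x \<in> U"
    "\<And>f g. \<lbrakk>f \<in> U; g \<in> U; Tgt C f = Src C g\<rbrakk> \<Longrightarrow> Cmp C g f \<in> U"
    using assms by (auto simp: broad_subcategory_def)
  have "Idn D y \<in> FAr F ` U" if "y \<in> Obj D" for y
    using U(2)[OF G.ob[OF that]] F.idn[OF G.ob[OF that]] FG_ob[OF that] by (metis imageI)
  moreover have "Cmp D (FAr F g) (FAr F f) \<in> FAr F ` U"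
    if "f \<in> U" "g \<in> U" "Tgt D (FAr F f) = Src D (FAr F g)" for f g
  proof -
    have ar: "f \<in> Arr C" "g \<in> Arr C" using that U(1) by auto
    then have "Tgt C f = Src C g"
      using that(3) by (simp add: F.src F.tgt FOb_eq_iff F.src.src_obj F.src.tgt_obj)
    with ar that show ?thesis using U(3) F.cmp by (metis imageI)
  qed
  ultimately show ?thesis
    using U(1) F.ar by (auto simp: broad_subcategory_def)
qed

text \<open>Endpoints are reflected by \<open>F\<close>, so the order axioms pull back to
  \<open>C\<close>. An arrow \<open>f\<close> is factored by mapping the factorization of
  \<open>FAr G f\<close> through \<open>F\<close>; any other factorization in the image comes from
  one of \<open>FAr G f\<close>, hence from the same one.\<close>

lemma inclusion_system_image:
  assumes "inclusion_system C (U, E)"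
  shows "inclusion_system D (FAr F ` U, FAr F ` E)"
proof -
  have bU: "broad_subcategory C U" and bE: "broad_subcategory C E"
    and po: "partial_order_arrows C U"
    and fac: "\<And>f. f \<in> Arr C \<Longrightarrow>
      \<exists>!(e, i). e \<in> E \<and> i \<in> U \<and> Tgt C e = Src C i \<and> Cmp C i e = f"
    using assms unfolding inclusion_system_def prod.case by blast+
  have UA: "\<And>f. f \<in> U \<Longrightarrow> f \<in> Arr C" and EA: "\<And>f. f \<in> E \<Longrightarrow> f \<in> Arr C"
    using bU bE by (auto simp: broad_subcategory_def)
  note st = F.src F.tgt FOb_eq_iff F.src.src_obj F.src.tgt_obj
  have po': "partial_order_arrows D (FAr F ` U)"
    unfolding partial_order_arrows_def
  proof (intro conjI ballI impI)
    fix f' g' assume "f' \<in> FAr F ` U" "g' \<in> FAr F ` U"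
    then obtain f g where f: "f' = FAr F f" "f \<in> U" and g: "g' = FAr F g" "g \<in> U" by blast
    show "f' = g'" if "Src D f' = Src D g' \<and> Tgt D f' = Tgt D g'"
    proof -
      have "Src C f = Src C g" "Tgt C f = Tgt C g"
        using that f g by (simp_all add: st UA)
      then have "f = g" using po f(2) g(2) unfolding partial_order_arrows_def by blast
      then show ?thesis by (simp add: f g)
    qed
    show "Src D f' = Tgt D f'" if "Src D f' = Tgt D g' \<and> Tgt D f' = Src D g'"
    proof -
      have "Src C f = Tgt C g" "Tgt C f = Src C g"
        using that f g by (simp_all add: st UA)
      then have "Src C f = Tgt C f" using po f(2) g(2) unfolding partial_order_arrows_def by blast
      then show ?thesis using f by (simp add: F.src F.tgt UA)
    qed
  qed
  have fac': "\<exists>!(e, i). e \<in> FAr F ` E \<and> i \<in> FAr F ` U \<and> Tgt D e = Src D i \<and> Cmp D i e = f"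
    if f: "f \<in> Arr D" for f
  proof -
    obtain q where q: "case q of (e, i) \<Rightarrow>
        e \<in> E \<and> i \<in> U \<and> Tgt C e = Src C i \<and> Cmp C i e = FAr G f"
      and q_uniq: "\<And>r. (case r of (e, i) \<Rightarrow>
        e \<in> E \<and> i \<in> U \<and> Tgt C e = Src C i \<and> Cmp C i e = FAr G f) \<Longrightarrow> r = q"
      using fac[OF G.ar[OF f]] by (elim ex1E) blast
    obtain e i where ei_q: "q = (e, i)" by (rule prod.exhaust)
    have ei: "e \<in> E" "i \<in> U" "Tgt C e = Src C i" "Cmp C i e = FAr G f"
      using q by (simp_all add: ei_q)
    have uniq: "e' = e \<and> i' = i"
      if "e' \<in> E" "i' \<in> U" "Tgt C e' = Src C i'" "Cmp C i' e' = FAr G f" for e' i'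
      using q_uniq[of "(e', i')"] that by (simp add: ei_q)
    show ?thesis
    proof (rule ex1I[of _ "(FAr F e, FAr F i)"])
      have "Tgt D (FAr F e) = Src D (FAr F i)" using ei by (simp add: st UA EA)
      moreover have "Cmp D (FAr F i) (FAr F e) = f"
        using F.cmp[OF EA UA, OF ei(1,2,3)] f by (simp add: ei(4) FG_ar)
      ultimately show "case (FAr F e, FAr F i) of (e, i) \<Rightarrow>
          e \<in> FAr F ` E \<and> i \<in> FAr F ` U \<and> Tgt D e = Src D i \<and> Cmp D i e = f"
        using ei by simp
    next
      fix p assume "case p of (e, i) \<Rightarrow>
        e \<in> FAr F ` E \<and> i \<in> FAr F ` U \<and> Tgt D e = Src D i \<and> Cmp D i e = f"
      then obtain e' i' where p: "p = (FAr F e', FAr F i')" and ei': "e' \<in> E" "i' \<in> U"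
        and t': "Tgt D (FAr F e') = Src D (FAr F i')" and c': "Cmp D (FAr F i') (FAr F e') = f"
        by (cases p) auto
      have t: "Tgt C e' = Src C i'" using t' ei' by (simp add: st UA EA)
      then have "FAr F (Cmp C i' e') = f"
        using F.cmp[OF EA UA] ei' c' by simp
      then have "Cmp C i' e' = FAr G f"
        using GF_ar[OF F.src.cmp_arr[OF EA UA t]] ei' by simp
      with uniq ei' t show "p = (FAr F e, FAr F i)" by (simp add: p)
    qed
  qed
  show ?thesis
    unfolding inclusion_system_def prod.case
    by (intro conjI ballI broad_subcategory_image bU bE po' fac')
qed

text \<open>The preimage \<open>u\<close> of the given inclusion is the witness, because
  \<open>G\<close> cancels \<open>F\<close> on its endpoints. The sets \<open>E\<close> and
  \<open>E'\<close> are arbitrary, as \<open>inclusion\<close> reads only the first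
  component.\<close>

lemma inclusion_image:
  assumes "U \<subseteq> Arr C" "inclusion D (FAr F ` U, E) m n"
  shows "inclusion C (U, E') (FOb G m) (FOb G n)"
proof -
  obtain u where "u \<in> U" "Src D (FAr F u) = m" "Tgt D (FAr F u) = n"
    using assms(2) by (auto simp: inclusion_def)
  moreover from this assms(1) have "u \<in> Arr C" by auto
  ultimately show ?thesis
    by (auto simp: inclusion_def F.src F.tgt GF_ob F.src.src_obj F.src.tgt_obj)
qed

end

section \<open>Lifting arrows along a fully faithful functor\<close>

lemma fully_faithful_inv_into:
  assumes "fully_faithful C D F" "x \<in> Obj C" "y \<in> Obj C"
    and "h \<in> hom_set D (FOb F x) (FOb F y)"
  shows "inv_into (hom_set C x y) (FAr F) h \<in> hom_set C x y"
    and "FAr F (inv_into (hom_set C x y) (FAr F) h) = h"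
proof -
  have "h \<in> FAr F ` hom_set C x y"
    using assms by (auto simp: fully_faithful_def bij_betw_def)
  then show "inv_into (hom_set C x y) (FAr F) h \<in> hom_set C x y"
    "FAr F (inv_into (hom_set C x y) (FAr F) h) = h"
    by (rule inv_into_into, rule f_inv_into_f)
qed

lemma fully_faithful_eqI:
  assumes "fully_faithful C D F" "x \<in> Obj C" "y \<in> Obj C"
    and "f \<in> hom_set C x y" "g \<in> hom_set C x y" "FAr F f = FAr F g"
  shows "f = g"
  using assms unfolding fully_faithful_def bij_betw_def inj_on_def by blast

section \<open>Category, functor and reduct laws in terms of hom sets\<close>

lemma (in category) cmp_hom:
  "\<lbrakk>f \<in> hom_set C x y; g \<in> hom_set C y z\<rbrakk> \<Longrightarrow> Cmp C g f \<in> hom_set C x z"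
  by (auto simp: hom_set_def cmp_arr src_cmp tgt_cmp)

lemma (in category) cmp_assoc_hom:
  "\<lbrakk>f \<in> hom_set C w x; g \<in> hom_set C x y; h \<in> hom_set C y z\<rbrakk>
    \<Longrightarrow> Cmp C (Cmp C h g) f = Cmp C h (Cmp C g f)"
  by (auto simp: hom_set_def cmp_assoc)

lemma (in category) idn_hom: "x \<in> Obj C \<Longrightarrow> Idn C x \<in> hom_set C x x"
  by (auto simp: hom_set_def idn_arr src_idn tgt_idn)

lemma (in category) cmp_idn_hom:
  "f \<in> hom_set C x y \<Longrightarrow> Cmp C f (Idn C x) = f"
  "f \<in> hom_set C x y \<Longrightarrow> Cmp C (Idn C y) f = f"
  by (auto simp: hom_set_def cmp_idn_right cmp_idn_left)

lemma (in is_functor) hom: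
  "f \<in> hom_set C x y \<Longrightarrow> FAr F f \<in> hom_set D (FOb F x) (FOb F y)"
  by (auto simp: hom_set_def ar src tgt)

lemma (in is_functor) cmp_of_hom:
  "\<lbrakk>f \<in> hom_set C x y; g \<in> hom_set C y z\<rbrakk>
    \<Longrightarrow> FAr F (Cmp C g f) = Cmp D (FAr F g) (FAr F f)"
  by (auto simp: hom_set_def cmp)

lemma (in indexed_category) red_hom:
  "f \<in> hom_set B x y \<Longrightarrow> is_functor (Fib X y) (Fib X x) (Red X f)"
  using red by (auto simp: hom_set_def)

lemma (in indexed_category) red_cmp_hom:
  assumes "f \<in> hom_set B x y" "g \<in> hom_set B y z"
  shows "m \<in> Obj (Fib X z) \<Longrightarrow> FOb (Red X (Cmp B g f)) m = FOb (Red X f) (FOb (Red X g) m)"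
    and "u \<in> Arr (Fib X z) \<Longrightarrow> FAr (Red X (Cmp B g f)) u = FAr (Red X f) (FAr (Red X g) u)"
  using assms by (auto simp: hom_set_def red_cmp_ob red_cmp_ar)

section \<open>The functor between Grothendieck categories induced by an institution
  morphism\<close>

definition grothendieck_map ::
  "('o2, 'a2, 'o1, 'a1) fnctr \<Rightarrow> ('o2 \<Rightarrow> ('m2, 'u2, 'm1, 'u1) fnctr)
    \<Rightarrow> ('o2 \<times> 'm2, ('o2 \<times> 'm2) \<times> ('a2 \<times> 'u2) \<times> ('o2 \<times> 'm2),
        'o1 \<times> 'm1, ('o1 \<times> 'm1) \<times> ('a1 \<times> 'u1) \<times> ('o1 \<times> 'm1)) fnctr" where
  "grothendieck_map \<phi> \<beta> = \<lparr>
     FOb = (\<lambda>(x, m). (FOb \<phi> x, FOb (\<beta> x) m)),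
     FAr = (\<lambda>((x, m), (f, u), (y, n)).
       ((FOb \<phi> x, FOb (\<beta> x) m), (FAr \<phi> f, FAr (\<beta> x) u), (FOb \<phi> y, FOb (\<beta> y) n)))\<rparr>"

text \<open>Naturality of \<open>\<beta>\<close> on objects makes the translated homomorphism end at
  the required reduct; naturality on arrows gives preservation of composition.\<close>

lemma (in institution_morphism) is_functor_grothendieck_map:
  "is_functor (grothendieck (Sig J) (Mod J)) (grothendieck (Sig I) (Mod I))
     (grothendieck_map \<phi> \<beta>)"
proof (intro is_functor.intro is_functor_axioms.intro J.category_grothendieck
    I.category_grothendieck)
  note b = mod[THEN is_functor.ob]
  fix p assume "p \<in> Obj (grothendieck (Sig J) (Mod J))"
  then show "FOb (grothendieck_map \<phi> \<beta>) p \<in> Obj (grothendieck (Sig I) (Mod I))"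
    and "FAr (grothendieck_map \<phi> \<beta>) (Idn (grothendieck (Sig J) (Mod J)) p)
      = Idn (grothendieck (Sig I) (Mod I)) (FOb (grothendieck_map \<phi> \<beta>) p)"
    by (auto simp: grothendieck_def grothendieck_map_def sig.ob sig.idn b
        mod[THEN is_functor.idn])
next
  fix a assume "a \<in> Arr (grothendieck (Sig J) (Mod J))"
  then obtain x m f u y n where a: "a = ((x, m), (f, u), (y, n))"
    and m: "m \<in> Obj (Models J x)" and n: "n \<in> Obj (Models J y)"
    and f: "f \<in> hom_set (Sig J) x y" and u: "u \<in> hom_set (Models J x) m (reduct J f n)"
    by (auto simp: grothendieck_def)
  have xy: "x \<in> Obj (Sig J)" "y \<in> Obj (Sig J)"
    using f J.base.src_obj[of f] J.base.tgt_obj[of f] by (auto simp: hom_set_def)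
  show "FAr (grothendieck_map \<phi> \<beta>) a \<in> Arr (grothendieck (Sig I) (Mod I))"
    using is_functor.hom[OF mod[OF xy(1)] u] sig.hom[OF f]
      is_functor.ob[OF mod[OF xy(1)] m] is_functor.ob[OF mod[OF xy(2)] n]
    by (simp add: a grothendieck_def grothendieck_map_def mod_natural_ob[OF f n])
  show "Src (grothendieck (Sig I) (Mod I)) (FAr (grothendieck_map \<phi> \<beta>) a)
      = FOb (grothendieck_map \<phi> \<beta>) (Src (grothendieck (Sig J) (Mod J)) a)"
    "Tgt (grothendieck (Sig I) (Mod I)) (FAr (grothendieck_map \<phi> \<beta>) a)
      = FOb (grothendieck_map \<phi> \<beta>) (Tgt (grothendieck (Sig J) (Mod J)) a)"
    by (simp_all add: a grothendieck_def grothendieck_map_def)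
next
  fix a b assume "a \<in> Arr (grothendieck (Sig J) (Mod J))" "b \<in> Arr (grothendieck (Sig J) (Mod J))"
    and "Tgt (grothendieck (Sig J) (Mod J)) a = Src (grothendieck (Sig J) (Mod J)) b"
  then obtain x m f u y n g v z l where a: "a = ((x, m), (f, u), (y, n))"
    and b: "b = ((y, n), (g, v), (z, l))"
    and n: "n \<in> Obj (Models J y)"
    and f: "f \<in> hom_set (Sig J) x y" and u: "u \<in> hom_set (Models J x) m (reduct J f n)"
    and g: "g \<in> hom_set (Sig J) y z" and v: "v \<in> hom_set (Models J y) n (reduct J g l)"
    by (auto simp: grothendieck_def)
  have x: "x \<in> Obj (Sig J)"
    using f J.base.src_obj[of f] by (auto simp: hom_set_def)
  have v': "v \<in> Arr (Models J y)" using v by (simp add: hom_set_def)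
  show "FAr (grothendieck_map \<phi> \<beta>) (Cmp (grothendieck (Sig J) (Mod J)) b a)
      = Cmp (grothendieck (Sig I) (Mod I)) (FAr (grothendieck_map \<phi> \<beta>) b)
          (FAr (grothendieck_map \<phi> \<beta>) a)"
    using is_functor.cmp_of_hom[OF mod[OF x] u is_functor.hom[OF J.red_hom[OF f] v]]
    by (simp add: a b grothendieck_def grothendieck_map_def sig.cmp_of_hom[OF f g]
        mod_natural_ar[OF f v'])
qed

section \<open>Transfer of a skolemization along a morphism\<close>

locale skolem_transfer = institution_morphism J I \<phi> \<alpha> \<beta> + sk: skolemization I K
  for I :: "('o1, 'a1, 's1, 'm1, 'u1) institution"
    and J :: "('o2, 'a2, 's2, 'm2, 'u2) institution"
    and K :: "('o1, 'a1, 's1, 'm1, 'u1) skolem"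
    and \<phi> :: "('o2, 'a2, 'o1, 'a1) fnctr"
    and \<alpha> :: "'o2 \<Rightarrow> 's1 \<Rightarrow> 's2"
    and \<beta> :: "'o2 \<Rightarrow> ('m2, 'u2, 'm1, 'u1) fnctr" +
  fixes til :: "'o2 \<Rightarrow> 'o2"
    and i :: "'o2 \<Rightarrow> 'a1"
  assumes ff: "fully_faithful (Sig J) (Sig I) \<phi>"
    and til: "x \<in> Obj (Sig J) \<Longrightarrow> til x \<in> Obj (Sig J)"
    and i: "x \<in> Obj (Sig J) \<Longrightarrow> i x \<in> hom_set (Sig I) (FOb \<phi> (til x)) (SkSig K (FOb \<phi> x))"
    and iso: "x \<in> Obj (Sig J) \<Longrightarrow> iso_arrow (Sig I) (i x)"
    and mod_iso: "x \<in> Obj (Sig J)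
      \<Longrightarrow> iso_of_categories (Models J x) (Models I (FOb \<phi> x)) (\<beta> x)"
    and sem_surj: "x \<in> Obj (Sig J)
      \<Longrightarrow> semantically_surjective J x (Sen I (FOb \<phi> x)) (\<alpha> x)"
begin

abbreviation skS :: "'o2 \<Rightarrow> 'o1" where
  "skS x \<equiv> SkSig K (FOb \<phi> x)"

definition j :: "'o2 \<Rightarrow> 'a1" where
  "j x = inv_arrow (Sig I) (i x)"

lemma inverse_i: "x \<in> Obj (Sig J) \<Longrightarrow> inverse_arrows (Sig I) (i x) (j x)"
  unfolding j_def by (rule I.base.inv_arrow[OF iso])

lemma j: "x \<in> Obj (Sig J) \<Longrightarrow> j x \<in> hom_set (Sig I) (skS x) (FOb \<phi> (til x))"
  and ji: "x \<in> Obj (Sig J) \<Longrightarrow> Cmp (Sig I) (j x) (i x) = Idn (Sig I) (FOb \<phi> (til x))"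
  and ij: "x \<in> Obj (Sig J) \<Longrightarrow> Cmp (Sig I) (i x) (j x) = Idn (Sig I) (skS x)"
  using inverse_i[of x] i[of x] by (auto simp: inverse_arrows_def hom_set_def)

definition T :: "'o2 \<Rightarrow> ('m1, 'u1, 'm2, 'u2) fnctr" where
  "T x = functor_comp (inv_functor (Models J (til x)) (\<beta> (til x))) (Red (Mod I) (i x))"

text \<open>Built from \<open>\<beta>\<close> and a reduct only, so naturality and the satisfaction
  conditions apply to it directly. Facts about \<open>T\<close> are derived from facts about
  \<open>G\<close>.\<close>

definition G :: "'o2 \<Rightarrow> ('m2, 'u2, 'm1, 'u1) fnctr" where
  "G x = functor_comp (Red (Mod I) (j x)) (\<beta> (til x))"

lemma functor_inverse_TG:
  assumes x: "x \<in> Obj (Sig J)"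
  shows "functor_inverse (Models I (skS x)) (Models J (til x)) (T x) (G x)"
proof -
  have "inverse_functors (Models I (skS x)) (Models I (FOb \<phi> (til x)))
      (Red (Mod I) (i x)) (Red (Mod I) (j x))"
    using I.inverse_functors_Red[OF inverse_i[OF x]] i[OF x] by (simp add: hom_set_def)
  from inverse_functors_comp[OF this inverse_functors_sym[OF
        inverse_functors_inv_functor[OF mod_iso[OF til[OF x]]]]]
  show ?thesis unfolding functor_inverse_def T_def G_def .
qed

text \<open>Used to cancel \<open>\<beta>\<close> from an equation of models that is first proved in
  \<open>I\<close>.\<close>

lemma \<beta>_eq_iff:
  "\<lbrakk>x \<in> Obj (Sig J); m \<in> Obj (Models J x); n \<in> Obj (Models J x)\<rbrakk>
    \<Longrightarrow> FOb (\<beta> x) m = FOb (\<beta> x) n \<longleftrightarrow> m = n"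
  by (rule functor_inverse.FOb_eq_iff[OF functor_inverse.intro[OF
        inverse_functors_inv_functor[OF mod_iso]]])

lemma \<phi>_ob: "x \<in> Obj (Sig J) \<Longrightarrow> FOb \<phi> x \<in> Obj (Sig I)"
  by (rule sig.ob)

lemma \<beta>_ob: "\<lbrakk>x \<in> Obj (Sig J); m \<in> Obj (Models J x)\<rbrakk>
    \<Longrightarrow> FOb (\<beta> x) m \<in> Obj (Models I (FOb \<phi> x))"
  using mod by (rule is_functor.ob)

section \<open>The Skolem axioms in \<open>J\<close>\<close>

definition skolem_pres :: "'o2 \<Rightarrow> 'o2 \<times> 's2 set" where
  "skolem_pres x =
     (til x, (\<lambda>s. \<alpha> (til x) (SenMap I (j x) s)) ` snd (SkPres K (FOb \<phi> x)))"

lemma SkPres_sen: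
  assumes x: "x \<in> Obj (Sig J)"
  shows "snd (SkPres K (FOb \<phi> x)) \<subseteq> Sen I (skS x)"
  using sk.sk_pres[OF \<phi>_ob[OF x]] by (auto simp: Pres_def SkSig_def)

lemma SenMap_j:
  assumes x: "x \<in> Obj (Sig J)" and s: "s \<in> snd (SkPres K (FOb \<phi> x))"
  shows "SenMap I (j x) s \<in> Sen I (FOb \<phi> (til x))"
  using I.sen_map[of "j x"] j[OF x] SkPres_sen[OF x] s by (auto simp: hom_set_def)

lemma skolem_pres_obj: "x \<in> Obj (Sig J) \<Longrightarrow> skolem_pres x \<in> Obj (Pres J)"
  using sen[OF til] SenMap_j by (auto simp: Pres_def skolem_pres_def til)

text \<open>For each axiom, the satisfaction condition of the morphism removes
  \<open>\<alpha>\<close> and moves to \<open>\<beta>\<close>, and the one of \<open>I\<close> along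
  \<open>j x\<close> replaces translation of the sentence by the reduct of the model.\<close>

lemma satisfies_all_skolem_pres:
  assumes x: "x \<in> Obj (Sig J)" and m: "m \<in> Obj (Models J (til x))"
  shows "satisfies_all J (skolem_pres x) m
    \<longleftrightarrow> satisfies_all I (SkPres K (FOb \<phi> x)) (FOb (G x) m)"
proof -
  have "Sat J (til x) m (\<alpha> (til x) (SenMap I (j x) s)) \<longleftrightarrow> Sat I (skS x) (FOb (G x) m) s"
    if s: "s \<in> snd (SkPres K (FOb \<phi> x))" for s
    using sat[OF til[OF x] m SenMap_j[OF x s]] SkPres_sen[OF x] s
      I.satisfaction[OF j[OF x] \<beta>_ob[OF til[OF x] m], of s]
    by (auto simp: G_def functor_comp_def)
  then show ?thesis by (simp add: satisfies_all_def skolem_pres_def SkSig_def)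
qed

section \<open>Pulling back arrows between Skolem signatures\<close>

definition sk_arr :: "'o2 \<Rightarrow> 'o2 \<Rightarrow> 'a1 \<Rightarrow> 'a2" where
  "sk_arr x y g = inv_into (hom_set (Sig J) (til x) (til y)) (FAr \<phi>)
     (Cmp (Sig I) (j y) (Cmp (Sig I) g (i x)))"

context
  fixes x y g
  assumes x: "x \<in> Obj (Sig J)" and y: "y \<in> Obj (Sig J)"
    and g: "g \<in> hom_set (Sig I) (skS x) (skS y)"
begin

lemma \<phi>_sk_arr_hom:
  "Cmp (Sig I) (j y) (Cmp (Sig I) g (i x))
    \<in> hom_set (Sig I) (FOb \<phi> (til x)) (FOb \<phi> (til y))"
  using I.base.cmp_hom i[OF x] g j[OF y] by blast

lemmas sk_arr_hom =
  fully_faithful_inv_into(1)[OF ff til[OF x] til[OF y] \<phi>_sk_arr_hom, folded sk_arr_def]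
lemmas \<phi>_sk_arr =
  fully_faithful_inv_into(2)[OF ff til[OF x] til[OF y] \<phi>_sk_arr_hom, folded sk_arr_def]

text \<open>Naturality square of \<open>j\<close>, by cancelling \<open>i x\<close> against
  \<open>j x\<close>. It governs both reducts along \<open>j\<close> and translations of Skolem
  axioms.\<close>

lemma \<phi>_sk_arr_j:
  "Cmp (Sig I) (FAr \<phi> (sk_arr x y g)) (j x) = Cmp (Sig I) (j y) g"
proof -
  have "Cmp (Sig I) (FAr \<phi> (sk_arr x y g)) (j x)
      = Cmp (Sig I) (j y) (Cmp (Sig I) (Cmp (Sig I) g (i x)) (j x))"
    unfolding \<phi>_sk_arr
    by (rule I.base.cmp_assoc_hom[OF j[OF x] I.base.cmp_hom[OF i[OF x] g] j[OF y]])
  also have "\<dots> = Cmp (Sig I) (j y) g"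
    by (simp add: I.base.cmp_assoc_hom[OF j[OF x] i[OF x] g] ij[OF x] I.base.cmp_idn_hom[OF g])
  finally show ?thesis .
qed

text \<open>Naturality square of \<open>i\<close>, by cancelling \<open>i y\<close> against
  \<open>j y\<close>; it is what makes \<open>sk_arr\<close> preserve composition.\<close>

lemma i_\<phi>_sk_arr:
  "Cmp (Sig I) (i y) (FAr \<phi> (sk_arr x y g)) = Cmp (Sig I) g (i x)"
  unfolding \<phi>_sk_arr
  using I.base.cmp_assoc_hom[OF I.base.cmp_hom[OF i[OF x] g] j[OF y] i[OF y], symmetric]
  by (simp add: ij[OF y] I.base.cmp_idn_hom(2)[OF I.base.cmp_hom[OF i[OF x] g]])

text \<open>Both sides are reducts of the same model \<open>FOb (\<beta> (til y)) m\<close>, along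
  the two composites that \<open>\<phi>_sk_arr_j\<close> identifies.\<close>

lemma G_reduct_ob:
  assumes m: "m \<in> Obj (Models J (til y))"
  shows "FOb (G x) (reduct J (sk_arr x y g) m) = reduct I g (FOb (G y) m)"
  using I.red_cmp_hom(1)[OF j[OF x] sig.hom[OF sk_arr_hom] \<beta>_ob[OF til[OF y] m]]
    I.red_cmp_hom(1)[OF g j[OF y] \<beta>_ob[OF til[OF y] m]]
  by (simp add: G_def functor_comp_def mod_natural_ob[OF sk_arr_hom m] \<phi>_sk_arr_j)

lemma G_reduct_ar:
  assumes u: "u \<in> Arr (Models J (til y))"
  shows "FAr (G x) (FAr (Red (Mod J) (sk_arr x y g)) u) = FAr (Red (Mod I) g) (FAr (G y) u)"
proof -
  note \<beta>u = is_functor.ar[OF mod[OF til[OF y]] u]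
  show ?thesis
    using I.red_cmp_hom(2)[OF j[OF x] sig.hom[OF sk_arr_hom] \<beta>u]
      I.red_cmp_hom(2)[OF g j[OF y] \<beta>u]
    by (simp add: G_def functor_comp_def mod_natural_ar[OF sk_arr_hom u] \<phi>_sk_arr_j)
qed

text \<open>Apply \<open>G_reduct_ob\<close> to \<open>FOb (T y) m\<close> and cancel
  \<open>G\<close> against \<open>T\<close> on both sides, so that the inverse inside
  \<open>T\<close> need not be unfolded.\<close>

lemma T_reduct_ob:
  assumes m: "m \<in> Obj (Models I (skS y))"
  shows "FOb (T x) (reduct I g m) = reduct J (sk_arr x y g) (FOb (T y) m)"
proof -
  interpret Tx: functor_inverse "Models I (skS x)" "Models J (til x)" "T x" "G x"
    by (rule functor_inverse_TG[OF x])
  interpret Ty: functor_inverse "Models I (skS y)" "Models J (til y)" "T y" "G y"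
    by (rule functor_inverse_TG[OF y])
  interpret R: is_functor "Models J (til y)" "Models J (til x)" "Red (Mod J) (sk_arr x y g)"
    by (rule J.red_hom[OF sk_arr_hom])
  show ?thesis
    using G_reduct_ob[OF Ty.F.ob[OF m]] Tx.FG_ob[OF R.ob[OF Ty.F.ob[OF m]]]
    by (simp add: Ty.GF_ob m)
qed

lemma T_reduct_ar:
  assumes u: "u \<in> Arr (Models I (skS y))"
  shows "FAr (T x) (FAr (Red (Mod I) g) u) = FAr (Red (Mod J) (sk_arr x y g)) (FAr (T y) u)"
proof -
  interpret Tx: functor_inverse "Models I (skS x)" "Models J (til x)" "T x" "G x"
    by (rule functor_inverse_TG[OF x])
  interpret Ty: functor_inverse "Models I (skS y)" "Models J (til y)" "T y" "G y"
    by (rule functor_inverse_TG[OF y])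
  interpret R: is_functor "Models J (til y)" "Models J (til x)" "Red (Mod J) (sk_arr x y g)"
    by (rule J.red_hom[OF sk_arr_hom])
  show ?thesis
    using G_reduct_ar[OF Ty.F.ar[OF u]] Tx.FG_ar[OF R.ar[OF Ty.F.ar[OF u]]]
    by (simp add: Ty.GF_ar u)
qed

text \<open>The axiom coming from \<open>s\<close> is sent to the axiom coming from
  \<open>SenMap I g s\<close>: naturality of \<open>\<alpha>\<close> moves the translation into
  \<open>I\<close>, where \<open>\<phi>_sk_arr_j\<close> applies.\<close>

lemma sk_arr_pres:
  assumes "SenMap I g ` snd (SkPres K (FOb \<phi> x)) \<subseteq> snd (SkPres K (FOb \<phi> y))"
  shows "(skolem_pres x, sk_arr x y g, skolem_pres y)
    \<in> hom_set (Pres J) (skolem_pres x) (skolem_pres y)"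
proof -
  have "SenMap J (sk_arr x y g) (\<alpha> (til x) (SenMap I (j x) s))
      = \<alpha> (til y) (SenMap I (j y) (SenMap I g s))"
    if s: "s \<in> snd (SkPres K (FOb \<phi> x))" for s
  proof -
    have s': "s \<in> Sen I (skS x)" using SkPres_sen[OF x] s by auto
    have "SenMap J (sk_arr x y g) (\<alpha> (til x) (SenMap I (j x) s))
        = \<alpha> (til y) (SenMap I (FAr \<phi> (sk_arr x y g)) (SenMap I (j x) s))"
      using sen_natural[OF sk_arr_hom SenMap_j[OF x s]] by simp
    also have "SenMap I (FAr \<phi> (sk_arr x y g)) (SenMap I (j x) s)
        = SenMap I (j y) (SenMap I g s)"
      using I.sen_cmp[of "j x" "FAr \<phi> (sk_arr x y g)" s] I.sen_cmp[of g "j y" s]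
        j[OF x] j[OF y] g sig.hom[OF sk_arr_hom] s' \<phi>_sk_arr_j
      by (simp add: hom_set_def)
    finally show ?thesis .
  qed
  then have "SenMap J (sk_arr x y g) ` snd (skolem_pres x) \<subseteq> snd (skolem_pres y)"
    using assms by (auto simp: skolem_pres_def)
  then show ?thesis
    using sk_arr_hom skolem_pres_obj[OF x] skolem_pres_obj[OF y]
    by (auto simp: Pres_def hom_set_def skolem_pres_def)
qed

end

lemma sk_arr_idn:
  assumes x: "x \<in> Obj (Sig J)"
  shows "sk_arr x x (Idn (Sig I) (skS x)) = Idn (Sig J) (til x)"
proof -
  have o: "skS x \<in> Obj (Sig I)"
    using i[OF x] I.base.tgt_obj[of "i x"] by (simp add: hom_set_def)
  show ?thesis
    using \<phi>_sk_arr[OF x x I.base.idn_hom[OF o]]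
    by (intro fully_faithful_eqI[OF ff til[OF x] til[OF x]
          sk_arr_hom[OF x x I.base.idn_hom[OF o]] J.base.idn_hom[OF til[OF x]]])
       (simp add: I.base.cmp_idn_hom[OF i[OF x]] ji[OF x] sig.idn[OF til[OF x]])
qed

text \<open>As \<open>\<phi>\<close> is faithful, it suffices to compare images in
  \<open>Sig I\<close>, where the inner \<open>i y\<close> and \<open>j y\<close> cancel.\<close>

lemma sk_arr_cmp:
  assumes x: "x \<in> Obj (Sig J)" and y: "y \<in> Obj (Sig J)" and z: "z \<in> Obj (Sig J)"
    and g: "g \<in> hom_set (Sig I) (skS x) (skS y)" and h: "h \<in> hom_set (Sig I) (skS y) (skS z)"
  shows "sk_arr x z (Cmp (Sig I) h g) = Cmp (Sig J) (sk_arr y z h) (sk_arr x y g)"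
proof -
  note hg = I.base.cmp_hom[OF g h]
  note sg = sk_arr_hom[OF x y g] and sh = sk_arr_hom[OF y z h]
  have "FAr \<phi> (Cmp (Sig J) (sk_arr y z h) (sk_arr x y g))
      = Cmp (Sig I) (FAr \<phi> (sk_arr y z h)) (FAr \<phi> (sk_arr x y g))"
    by (rule sig.cmp_of_hom[OF sg sh])
  also have "\<dots> = Cmp (Sig I) (j z) (Cmp (Sig I) (Cmp (Sig I) h (i y)) (FAr \<phi> (sk_arr x y g)))"
    unfolding \<phi>_sk_arr[OF y z h]
    by (rule I.base.cmp_assoc_hom[OF sig.hom[OF sg] I.base.cmp_hom[OF i[OF y] h] j[OF z]])
  also have "\<dots> = Cmp (Sig I) (j z) (Cmp (Sig I) (Cmp (Sig I) h g) (i x))"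
    by (simp add: I.base.cmp_assoc_hom[OF sig.hom[OF sg] i[OF y] h] i_\<phi>_sk_arr[OF x y g]
        I.base.cmp_assoc_hom[OF i[OF x] g h])
  also have "\<dots> = FAr \<phi> (sk_arr x z (Cmp (Sig I) h g))"
    by (rule \<phi>_sk_arr[OF x z hg, symmetric])
  finally show ?thesis
    by (intro fully_faithful_eqI[OF ff til[OF x] til[OF z] sk_arr_hom[OF x z hg]
          J.base.cmp_hom[OF sg sh]]) simp
qed


section \<open>The Skolem functor of \<open>J\<close>\<close>

definition U where
  "U = functor_comp (SkFun K) (grothendieck_map \<phi> \<beta>)"

sublocale U: is_functor "grothendieck (Sig J) (Mod J)" "grothendieck (Pres I) (ModPres I)" U
  unfolding U_def by (rule is_functor_functor_comp[OF is_functor_grothendieck_map sk.sk_functor])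

definition sk_mod :: "'o2 \<Rightarrow> 'm2 \<Rightarrow> 'm1" where
  "sk_mod x m = SkMod K (FOb \<phi> x) (FOb (\<beta> x) m)"

lemma U_ob:
  "\<lbrakk>x \<in> Obj (Sig J); m \<in> Obj (Models J x)\<rbrakk>
    \<Longrightarrow> FOb U (x, m) = (SkPres K (FOb \<phi> x), sk_mod x m)"
  using sk.sk_functor_pres[OF \<phi>_ob \<beta>_ob]
  by (simp add: U_def functor_comp_def grothendieck_map_def sk_mod_def SkMod_def prod_eq_iff)

lemma sk_mod:
  assumes x: "x \<in> Obj (Sig J)" and m: "m \<in> Obj (Models J x)"
  shows "sk_mod x m \<in> Obj (Models I (skS x))"
    and "satisfies_all I (SkPres K (FOb \<phi> x)) (sk_mod x m)"
  using U.ob[of "(x, m)"] U_ob[OF x m] x m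
  by (auto simp: grothendieck_def ModPres_def full_subcat_def SkSig_def)

text \<open>The arrow part of the given Skolem functor is abstract. Functoriality forces the
  endpoints of its values, and membership in the target category supplies the signature arrow
  \<open>g\<close> and the homomorphism \<open>v\<close>.\<close>

lemma U_ar:
  assumes a: "((x, m), (f, u), (y, n)) \<in> Arr (grothendieck (Sig J) (Mod J))"
  obtains g v where
    "FAr U ((x, m), (f, u), (y, n)) =
      ((SkPres K (FOb \<phi> x), sk_mod x m),
       ((SkPres K (FOb \<phi> x), g, SkPres K (FOb \<phi> y)), v),
       (SkPres K (FOb \<phi> y), sk_mod y n))"
    "g \<in> hom_set (Sig I) (skS x) (skS y)"
    "SenMap I g ` snd (SkPres K (FOb \<phi> x)) \<subseteq> snd (SkPres K (FOb \<phi> y))"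
    "v \<in> hom_set (Models I (skS x)) (sk_mod x m) (reduct I g (sk_mod y n))"
proof -
  let ?a = "((x, m), (f, u), (y, n))"
  have mn: "x \<in> Obj (Sig J)" "y \<in> Obj (Sig J)" "m \<in> Obj (Models J x)" "n \<in> Obj (Models J y)"
    using a J.base.src_obj[of f] J.base.tgt_obj[of f] by (auto simp: grothendieck_def hom_set_def)
  obtain p w q where w: "FAr U ?a = (p, w, q)" by (cases "FAr U ?a")
  have p: "p = (SkPres K (FOb \<phi> x), sk_mod x m)" and q: "q = (SkPres K (FOb \<phi> y), sk_mod y n)"
    using U.src[OF a] U.tgt[OF a] w by (simp_all add: grothendieck_def U_ob mn)
  obtain h v where hv: "w = (h, v)" by (cases w)
  have "(p, (h, v), q) \<in> Arr (grothendieck (Pres I) (ModPres I))"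
    using U.ar[OF a] w hv by simp
  then have h: "h \<in> hom_set (Pres I) (SkPres K (FOb \<phi> x)) (SkPres K (FOb \<phi> y))"
    and v: "v \<in> hom_set (Fib (ModPres I) (SkPres K (FOb \<phi> x))) (sk_mod x m)
      (FOb (Red (ModPres I) h) (sk_mod y n))"
    by (simp_all add: grothendieck_def p q)
  obtain g where g: "h = (SkPres K (FOb \<phi> x), g, SkPres K (FOb \<phi> y))"
    "g \<in> hom_set (Sig I) (skS x) (skS y)"
    "SenMap I g ` snd (SkPres K (FOb \<phi> x)) \<subseteq> snd (SkPres K (FOb \<phi> y))"
    using h by (cases "SkPres K (FOb \<phi> x)"; cases "SkPres K (FOb \<phi> y)")
      (auto simp: Pres_def hom_set_def SkSig_def)
  show ?thesis
    using that[of g v] v g w hv p q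
    by (auto simp: ModPres_def full_subcat_def hom_set_def SkSig_def)
qed

text \<open>The signatures \<open>x\<close> and \<open>y\<close> are arguments because an arrow
  between Skolem presentations over \<open>I\<close> does not determine them;
  \<open>skolem_functor\<close> reads them off the original arrow.\<close>

definition transfer_arr where
  "transfer_arr x y = (\<lambda>(p, ((_, g, _), v), q).
     ((skolem_pres x, FOb (T x) (snd p)),
      ((skolem_pres x, sk_arr x y g, skolem_pres y), FAr (T x) v),
      (skolem_pres y, FOb (T y) (snd q))))"

definition skolem_functor where
  "skolem_functor = \<lparr>
     FOb = (\<lambda>(x, m). (skolem_pres x, FOb (T x) (sk_mod x m))),
     FAr = (\<lambda>a. transfer_arr (fst (fst a)) (fst (snd (snd a))) (FAr U a))\<rparr>"

lemma T_sk_mod: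
  assumes x: "x \<in> Obj (Sig J)" and m: "m \<in> Obj (Models J x)"
  shows "FOb (T x) (sk_mod x m) \<in> Obj (Models J (til x))"
    and "satisfies_all J (skolem_pres x) (FOb (T x) (sk_mod x m))"
proof -
  interpret T: functor_inverse "Models I (skS x)" "Models J (til x)" "T x" "G x"
    by (rule functor_inverse_TG[OF x])
  show o: "FOb (T x) (sk_mod x m) \<in> Obj (Models J (til x))"
    by (rule T.F.ob[OF sk_mod(1)[OF x m]])
  show "satisfies_all J (skolem_pres x) (FOb (T x) (sk_mod x m))"
    by (simp add: satisfies_all_skolem_pres[OF x o] T.GF_ob sk_mod[OF x m])
qed

text \<open>All structure is inherited from \<open>U\<close>. Naturality of \<open>T\<close> places
  the transported homomorphisms over the pulled back signature arrows, and functoriality of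
  \<open>sk_arr\<close> handles the signature component.\<close>

lemma is_functor_skolem_functor:
  "is_functor (grothendieck (Sig J) (Mod J)) (grothendieck (Pres J) (ModPres J)) skolem_functor"
proof (intro is_functor.intro is_functor_axioms.intro J.category_grothendieck
    indexed_category.category_grothendieck[OF J.indexed_category_ModPres])
  fix p assume "p \<in> Obj (grothendieck (Sig J) (Mod J))"
  then obtain x m where p: "p = (x, m)" and x: "x \<in> Obj (Sig J)" and m: "m \<in> Obj (Models J x)"
    by (auto simp: grothendieck_def)
  interpret T: functor_inverse "Models I (skS x)" "Models J (til x)" "T x" "G x"
    by (rule functor_inverse_TG[OF x])
  show "FOb skolem_functor p \<in> Obj (grothendieck (Pres J) (ModPres J))"
    using skolem_pres_obj[OF x] T_sk_mod[OF x m]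
    by (simp add: p skolem_functor_def grothendieck_def ModPres_def full_subcat_def)
       (simp add: skolem_pres_def)
  have "FAr U (Idn (grothendieck (Sig J) (Mod J)) p)
      = Idn (grothendieck (Pres I) (ModPres I)) (SkPres K (FOb \<phi> x), sk_mod x m)"
    using U.idn[of p] U_ob[OF x m] x m by (simp add: p grothendieck_def)
  also have "\<dots> = ((SkPres K (FOb \<phi> x), sk_mod x m),
      ((SkPres K (FOb \<phi> x), Idn (Sig I) (skS x), SkPres K (FOb \<phi> x)),
       Idn (Models I (skS x)) (sk_mod x m)), (SkPres K (FOb \<phi> x), sk_mod x m))"
    by (simp add: grothendieck_def Pres_def ModPres_def full_subcat_def SkSig_def)
  finally show "FAr skolem_functor (Idn (grothendieck (Sig J) (Mod J)) p)
      = Idn (grothendieck (Pres J) (ModPres J)) (FOb skolem_functor p)"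
    using T.F.idn[OF sk_mod(1)[OF x m]]
    by (simp add: p skolem_functor_def transfer_arr_def grothendieck_def)
       (simp add: Pres_def ModPres_def full_subcat_def skolem_pres_def sk_arr_idn[OF x])
next
  fix a assume aA: "a \<in> Arr (grothendieck (Sig J) (Mod J))"
  obtain x m f u y n where a: "a = ((x, m), (f, u), (y, n))" by (metis prod.exhaust)
  have mn: "x \<in> Obj (Sig J)" "y \<in> Obj (Sig J)" "m \<in> Obj (Models J x)" "n \<in> Obj (Models J y)"
    using aA a J.base.src_obj[of f] J.base.tgt_obj[of f]
    by (auto simp: grothendieck_def hom_set_def)
  obtain g v where Ua: "FAr U a = ((SkPres K (FOb \<phi> x), sk_mod x m),
       ((SkPres K (FOb \<phi> x), g, SkPres K (FOb \<phi> y)), v), (SkPres K (FOb \<phi> y), sk_mod y n))"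
    and g: "g \<in> hom_set (Sig I) (skS x) (skS y)"
    and gS: "SenMap I g ` snd (SkPres K (FOb \<phi> x)) \<subseteq> snd (SkPres K (FOb \<phi> y))"
    and v: "v \<in> hom_set (Models I (skS x)) (sk_mod x m) (reduct I g (sk_mod y n))"
    using U_ar[OF aA[unfolded a], folded a] .
  interpret T: functor_inverse "Models I (skS x)" "Models J (til x)" "T x" "G x"
    by (rule functor_inverse_TG[OF mn(1)])
  have Sa: "FAr skolem_functor a = ((skolem_pres x, FOb (T x) (sk_mod x m)),
      ((skolem_pres x, sk_arr x y g, skolem_pres y), FAr (T x) v),
      (skolem_pres y, FOb (T y) (sk_mod y n)))"
    by (simp add: skolem_functor_def transfer_arr_def Ua) (simp add: a)
  have Tv: "FAr (T x) v \<in> hom_set (Models J (til x)) (FOb (T x) (sk_mod x m))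
      (reduct J (sk_arr x y g) (FOb (T y) (sk_mod y n)))"
    using T.F.hom[OF v] T_reduct_ob[OF mn(1,2) g sk_mod(1)[OF mn(2,4)]] by simp
  \<comment> \<open>An arrow of the full subcategory needs both endpoints to satisfy the axioms. The
    target is a reduct along a presentation arrow, and such reducts preserve satisfaction.\<close>
  have sat: "satisfies_all J (skolem_pres x) (reduct J (sk_arr x y g) (FOb (T y) (sk_mod y n)))"
  proof -
    have "is_functor (Fib (ModPres J) (skolem_pres y)) (Fib (ModPres J) (skolem_pres x))
        (Red (Mod J) (sk_arr x y g))"
      using indexed_category.red_hom[OF J.indexed_category_ModPres
          sk_arr_pres[OF mn(1,2) g gS]] by (simp add: ModPres_def)
    from is_functor.ob[OF this, of "FOb (T y) (sk_mod y n)"] T_sk_mod[OF mn(2,4)]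
    show ?thesis by (simp add: ModPres_def full_subcat_def) (simp add: skolem_pres_def)
  qed
  show "FAr skolem_functor a \<in> Arr (grothendieck (Pres J) (ModPres J))"
    using sk_arr_pres[OF mn(1,2) g gS] T_sk_mod[OF mn(1,3)] T_sk_mod[OF mn(2,4)] Tv sat
    unfolding Sa
    by (simp add: grothendieck_def ModPres_def full_subcat_def hom_set_def)
       (simp add: skolem_pres_def)
  show "Src (grothendieck (Pres J) (ModPres J)) (FAr skolem_functor a)
      = FOb skolem_functor (Src (grothendieck (Sig J) (Mod J)) a)"
    "Tgt (grothendieck (Pres J) (ModPres J)) (FAr skolem_functor a)
      = FOb skolem_functor (Tgt (grothendieck (Sig J) (Mod J)) a)"
    unfolding Sa by (simp_all add: a skolem_functor_def grothendieck_def)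
next
  fix a b assume aA: "a \<in> Arr (grothendieck (Sig J) (Mod J))"
    and bA: "b \<in> Arr (grothendieck (Sig J) (Mod J))"
    and ab: "Tgt (grothendieck (Sig J) (Mod J)) a = Src (grothendieck (Sig J) (Mod J)) b"
  then obtain x m f u y n f' u' z l where a: "a = ((x, m), (f, u), (y, n))"
    and b: "b = ((y, n), (f', u'), (z, l))"
    by (cases a; cases b) (auto simp: grothendieck_def)
  have xyz: "x \<in> Obj (Sig J)" "y \<in> Obj (Sig J)" "z \<in> Obj (Sig J)"
    using aA bA a b J.base.src_obj[of f] J.base.tgt_obj[of f] J.base.tgt_obj[of f']
    by (auto simp: grothendieck_def hom_set_def)
  obtain g v where Ua: "FAr U a = ((SkPres K (FOb \<phi> x), sk_mod x m),
       ((SkPres K (FOb \<phi> x), g, SkPres K (FOb \<phi> y)), v), (SkPres K (FOb \<phi> y), sk_mod y n))"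
    and g: "g \<in> hom_set (Sig I) (skS x) (skS y)"
    and v: "v \<in> hom_set (Models I (skS x)) (sk_mod x m) (reduct I g (sk_mod y n))"
    using U_ar[OF aA[unfolded a], folded a] .
  obtain h w where Ub: "FAr U b = ((SkPres K (FOb \<phi> y), sk_mod y n),
       ((SkPres K (FOb \<phi> y), h, SkPres K (FOb \<phi> z)), w), (SkPres K (FOb \<phi> z), sk_mod z l))"
    and h: "h \<in> hom_set (Sig I) (skS y) (skS z)"
    and w: "w \<in> hom_set (Models I (skS y)) (sk_mod y n) (reduct I h (sk_mod z l))"
    using U_ar[OF bA[unfolded b], folded b] .
  interpret T: functor_inverse "Models I (skS x)" "Models J (til x)" "T x" "G x"
    by (rule functor_inverse_TG[OF xyz(1)])
  have w': "w \<in> Arr (Models I (skS y))" using w by (simp add: hom_set_def)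
  have "FAr U (Cmp (grothendieck (Sig J) (Mod J)) b a) =
      ((SkPres K (FOb \<phi> x), sk_mod x m),
       ((SkPres K (FOb \<phi> x), Cmp (Sig I) h g, SkPres K (FOb \<phi> z)),
        Cmp (Models I (skS x)) (FAr (Red (Mod I) g) w) v), (SkPres K (FOb \<phi> z), sk_mod z l))"
    unfolding U.cmp[OF aA bA ab] Ua Ub
    by (simp add: grothendieck_def Pres_def ModPres_def full_subcat_def SkSig_def)
  moreover have "fst (fst (Cmp (grothendieck (Sig J) (Mod J)) b a)) = x"
    "fst (snd (snd (Cmp (grothendieck (Sig J) (Mod J)) b a))) = z"
    by (simp_all add: a b grothendieck_def)
  moreover have "FAr skolem_functor a = transfer_arr x y (FAr U a)"
    "FAr skolem_functor b = transfer_arr y z (FAr U b)"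
    unfolding skolem_functor_def by (simp_all add: a b)
  \<comment> \<open>\<open>T x\<close> distributes over the composite of \<open>v\<close> with the
    reduct of \<open>w\<close>; \<open>T_reduct_ar\<close> then exchanges \<open>T\<close> with that
    reduct.\<close>
  ultimately show "FAr skolem_functor (Cmp (grothendieck (Sig J) (Mod J)) b a)
      = Cmp (grothendieck (Pres J) (ModPres J)) (FAr skolem_functor b) (FAr skolem_functor a)"
    using T.F.cmp_of_hom[OF v is_functor.hom[OF I.red_hom[OF g] w]]
    by (simp add: Ua Ub transfer_arr_def)
       (simp add: skolem_functor_def transfer_arr_def grothendieck_def Pres_def ModPres_def
        full_subcat_def sk_arr_cmp[OF xyz g h] T_reduct_ar[OF xyz(1,2) g w'] skolem_pres_def)
qed

section \<open>The arrows into the Skolem signatures, and elementary equivalence\<close>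

definition skolem_tau :: "'o2 \<Rightarrow> 'a2" where
  "skolem_tau x = inv_into (hom_set (Sig J) x (til x)) (FAr \<phi>)
     (Cmp (Sig I) (j x) (SkTau K (FOb \<phi> x)))"

lemma \<phi>_skolem_tau_hom:
  "x \<in> Obj (Sig J) \<Longrightarrow> Cmp (Sig I) (j x) (SkTau K (FOb \<phi> x))
    \<in> hom_set (Sig I) (FOb \<phi> x) (FOb \<phi> (til x))"
  using I.base.cmp_hom sk.sk_tau[OF \<phi>_ob] j by blast

lemma skolem_tau_hom: "x \<in> Obj (Sig J) \<Longrightarrow> skolem_tau x \<in> hom_set (Sig J) x (til x)"
  and \<phi>_skolem_tau: "x \<in> Obj (Sig J)
    \<Longrightarrow> FAr \<phi> (skolem_tau x) = Cmp (Sig I) (j x) (SkTau K (FOb \<phi> x))"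
  unfolding skolem_tau_def
  using fully_faithful_inv_into[OF ff _ til \<phi>_skolem_tau_hom] by blast+

text \<open>Naturality of \<open>\<beta>\<close> turns the left side into a reduct along
  \<open>j x\<close> after the given arrow; splitting it leaves the part along \<open>j x\<close>,
  which belongs to \<open>G x\<close>.\<close>

lemma \<beta>_reduct_skolem_tau:
  assumes x: "x \<in> Obj (Sig J)" and m: "m \<in> Obj (Models J (til x))"
  shows "FOb (\<beta> x) (reduct J (skolem_tau x) m)
    = reduct I (SkTau K (FOb \<phi> x)) (FOb (G x) m)"
  using I.red_cmp_hom(1)[OF sk.sk_tau[OF \<phi>_ob[OF x]] j[OF x] \<beta>_ob[OF til[OF x] m]]
  by (simp add: mod_natural_ob[OF skolem_tau_hom[OF x] m] \<phi>_skolem_tau[OF x] G_def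
      functor_comp_def)

text \<open>Semantic surjectivity replaces a sentence of \<open>J\<close> by some
  \<open>\<alpha> x t\<close> with the same models, and its truth in a model is the truth of
  \<open>t\<close> in the image under \<open>\<beta>\<close>.\<close>

lemma model_star_eqI:
  assumes x: "x \<in> Obj (Sig J)" and m: "m \<in> Obj (Models J x)" and n: "n \<in> Obj (Models J x)"
    and eq: "model_star I (FOb \<phi> x) (FOb (\<beta> x) m) = model_star I (FOb \<phi> x) (FOb (\<beta> x) n)"
  shows "model_star J x m = model_star J x n"
proof -
  have "Sat J x m s \<longleftrightarrow> Sat J x n s" if s: "s \<in> Sen J x" for s
  proof -
    obtain t where t: "t \<in> Sen I (FOb \<phi> x)" "sentence_star J x s = sentence_star J x (\<alpha> x t)"
      using sem_surj[OF x] s by (auto simp: semantically_surjective_def)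
    have "Sat J x k s \<longleftrightarrow> t \<in> model_star I (FOb \<phi> x) (FOb (\<beta> x) k)"
      if k: "k \<in> Obj (Models J x)" for k
      using t k sat[OF x k t(1)] by (auto simp: sentence_star_def model_star_def)
    then show ?thesis using m n eq by simp
  qed
  then show ?thesis by (auto simp: model_star_def)
qed

section \<open>Assembling the skolemization of \<open>J\<close>\<close>

definition skolem_J :: "('o2, 'a2, 's2, 'm2, 'u2) skolem" where
  "skolem_J = \<lparr>
     SkFun = skolem_functor,
     SkPres = skolem_pres,
     SkIncl = (\<lambda>x. map_prod (image (FAr (T x))) (image (FAr (T x))) (SkIncl K (FOb \<phi> x))),
     SkTau = skolem_tau\<rparr>"

lemma SkSig_skolem_J: "SkSig skolem_J x = til x"
  by (simp add: SkSig_def skolem_J_def skolem_pres_def)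

text \<open>The reduct condition is \<open>\<beta>_reduct_skolem_tau\<close> and the axioms are
  \<open>satisfies_all_skolem_pres\<close>. It makes \<open>sk_elementary\<close> of
  \<open>I\<close> applicable to skolemizations in \<open>J\<close>.\<close>

lemma skolemization_of_G:
  assumes x: "x \<in> Obj (Sig J)" and m': "skolemization_of J skolem_J x m' m"
  shows "skolemization_of I K (FOb \<phi> x) (FOb (G x) m') (FOb (\<beta> x) m)"
proof -
  interpret T: functor_inverse "Models I (skS x)" "Models J (til x)" "T x" "G x"
    by (rule functor_inverse_TG[OF x])
  have "m' \<in> Obj (Models J (til x))" "reduct J (skolem_tau x) m' = m"
    "satisfies_all J (skolem_pres x) m'"
    using m' by (simp_all add: skolemization_of_def SkSig_skolem_J) (simp_all add: skolem_J_def)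
  then show ?thesis
    using \<beta>_reduct_skolem_tau[OF x] satisfies_all_skolem_pres[OF x]
    by (auto simp: skolemization_of_def T.G.ob)
qed

lemma skolemization_skolem_J: "skolemization J skolem_J"
proof (intro skolemization.intro skolemization_axioms.intro J.is_institution_axioms)
  show "is_functor (grothendieck (Sig J) (Mod J)) (grothendieck (Pres J) (ModPres J))
      (SkFun skolem_J)"
    by (simp add: skolem_J_def is_functor_skolem_functor)
next
  fix x assume x: "x \<in> Obj (Sig J)"
  interpret T: functor_inverse "Models I (skS x)" "Models J (til x)" "T x" "G x"
    by (rule functor_inverse_TG[OF x])
  obtain V E where VE: "SkIncl K (FOb \<phi> x) = (V, E)" by (rule prod.exhaust)
  have incl: "inclusion_system (Models I (skS x)) (V, E)"
    using sk.sk_inclusion_system[OF \<phi>_ob[OF x]] VE by simp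
  show "SkPres skolem_J x \<in> Obj (Pres J)"
    by (simp add: skolem_J_def skolem_pres_obj[OF x])
  show "SkTau skolem_J x \<in> hom_set (Sig J) x (SkSig skolem_J x)"
    by (simp add: SkSig_skolem_J) (simp add: skolem_J_def skolem_tau_hom[OF x])
  show "inclusion_system (Models J (SkSig skolem_J x)) (SkIncl skolem_J x)"
    using T.inclusion_system_image[OF incl] VE
    by (simp add: SkSig_skolem_J) (simp add: skolem_J_def)
  fix m assume m: "m \<in> Obj (Models J x)"
  show "fst (FOb (SkFun skolem_J) (x, m)) = SkPres skolem_J x"
    by (simp add: skolem_J_def skolem_functor_def)
  let ?m = "FOb (T x) (sk_mod x m)"
  \<comment> \<open>After \<open>\<beta>\<close> the equation becomes the reduct law of the given
    skolemization, since \<open>G x\<close> undoes the \<open>T x\<close> in \<open>?m\<close>;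
    injectivity of \<open>\<beta>\<close> on models then removes \<open>\<beta>\<close>.\<close>
  have "FOb (\<beta> x) (reduct J (skolem_tau x) ?m) = FOb (\<beta> x) m"
    using \<beta>_reduct_skolem_tau[OF x T_sk_mod(1)[OF x m]] sk_mod(1)[OF x m]
      sk.sk_reduct[OF \<phi>_ob[OF x] \<beta>_ob[OF x m]]
    by (simp add: T.GF_ob sk_mod_def)
  then have "reduct J (skolem_tau x) ?m = m"
    using is_functor.ob[OF J.red_hom[OF skolem_tau_hom[OF x]] T_sk_mod(1)[OF x m]]
    by (simp add: \<beta>_eq_iff[OF x _ m])
  then show "reduct J (SkTau skolem_J x) (SkMod skolem_J x m) = m"
    by (simp add: skolem_J_def SkMod_def skolem_functor_def)
  fix n m' n' assume n: "n \<in> Obj (Models J x)"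
    and sm: "skolemization_of J skolem_J x m' m" and sn: "skolemization_of J skolem_J x n' n"
    and mn: "inclusion (Models J (SkSig skolem_J x)) (SkIncl skolem_J x) m' n'"
  have "inclusion (Models J (til x)) (FAr (T x) ` V, FAr (T x) ` E) m' n'"
    using mn VE by (simp add: SkSig_skolem_J) (simp add: skolem_J_def)
  \<comment> \<open>The inclusion is pulled back to \<open>I\<close>, where the elementarity
    hypothesis is available.\<close>
  then have "inclusion (Models I (skS x)) (SkIncl K (FOb \<phi> x)) (FOb (G x) m') (FOb (G x) n')"
    using T.inclusion_image incl VE by (simp add: inclusion_system_def broad_subcategory_def)
  from sk.sk_elementary[OF \<phi>_ob[OF x] \<beta>_ob[OF x m] \<beta>_ob[OF x n]
      skolemization_of_G[OF x sm] skolemization_of_G[OF x sn] this]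
  show "model_star J x m = model_star J x n"
    by (rule model_star_eqI[OF x m n])
qed

end

theorem theorem14:
  fixes I :: "('o1, 'a1, 's1, 'm1, 'u1) institution"
    and J :: "('o2, 'a2, 's2, 'm2, 'u2) institution"
    and K :: "('o1, 'a1, 's1, 'm1, 'u1) skolem"
    and \<phi> :: "('o2, 'a2, 'o1, 'a1) fnctr"
    and \<alpha> :: "'o2 \<Rightarrow> 's1 \<Rightarrow> 's2"
    and \<beta> :: "'o2 \<Rightarrow> ('m2, 'u2, 'm1, 'u1) fnctr"
    and til :: "'o2 \<Rightarrow> 'o2"
    and i :: "'o2 \<Rightarrow> 'a1"
  assumes "skolemization I K"
    and "institution_morphism J I \<phi> \<alpha> \<beta>"
    and "fully_faithful (Sig J) (Sig I) \<phi>"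
    and "\<forall>\<Sigma>\<in>Obj (Sig J). til \<Sigma> \<in> Obj (Sig J) \<and>
           i \<Sigma> \<in> hom_set (Sig I) (FOb \<phi> (til \<Sigma>)) (SkSig K (FOb \<phi> \<Sigma>)) \<and>
           iso_arrow (Sig I) (i \<Sigma>)"
    and "\<forall>\<Sigma>\<in>Obj (Sig J). iso_of_categories (Models J \<Sigma>) (Models I (FOb \<phi> \<Sigma>)) (\<beta> \<Sigma>)"
    and "\<forall>\<Sigma>\<in>Obj (Sig J). semantically_surjective J \<Sigma> (Sen I (FOb \<phi> \<Sigma>)) (\<alpha> \<Sigma>)"
  shows "\<exists>K' :: ('o2, 'a2, 's2, 'm2, 'u2) skolem.
    skolemization J K' \<and>
    (\<forall>\<Sigma>\<in>Obj (Sig J).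
       SkSig K' \<Sigma> = til \<Sigma> \<and>
       (SkTau K' \<Sigma> \<in> hom_set (Sig J) \<Sigma> (til \<Sigma>) \<and>
        FAr \<phi> (SkTau K' \<Sigma>) =
          Cmp (Sig I) (inv_arrow (Sig I) (i \<Sigma>)) (SkTau K (FOb \<phi> \<Sigma>)) \<and>
        (\<forall>t\<in>hom_set (Sig J) \<Sigma> (til \<Sigma>).
           FAr \<phi> t = Cmp (Sig I) (inv_arrow (Sig I) (i \<Sigma>)) (SkTau K (FOb \<phi> \<Sigma>))
             \<longrightarrow> t = SkTau K' \<Sigma>)) \<and>
       (\<forall>U E. SkIncl K (FOb \<phi> \<Sigma>) = (U, E) \<longrightarrow>
          (let F = functor_comp (inv_functor (Models J (til \<Sigma>)) (\<beta> (til \<Sigma>)))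
                     (Red (Mod I) (i \<Sigma>))
           in SkIncl K' \<Sigma> = (FAr F ` U, FAr F ` E))))"
proof -
  interpret skolem_transfer I J K \<phi> \<alpha> \<beta> til i
    using assms by (simp add: skolem_transfer_def skolem_transfer_axioms_def)
  \<comment> \<open>Uniqueness is faithfulness of \<open>\<phi>\<close>: both arrows lie in the same
    hom set and have the same image.\<close>
  have "t = SkTau skolem_J \<Sigma>"
    if "\<Sigma> \<in> Obj (Sig J)" "t \<in> hom_set (Sig J) \<Sigma> (til \<Sigma>)"
      "FAr \<phi> t = Cmp (Sig I) (inv_arrow (Sig I) (i \<Sigma>)) (SkTau K (FOb \<phi> \<Sigma>))" for \<Sigma> t
    using that skolem_tau_hom[of \<Sigma>] \<phi>_skolem_tau[of \<Sigma>] til[of \<Sigma>]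
    by (simp add: skolem_J_def j_def fully_faithful_eqI[OF ff])
  then show ?thesis
    using skolemization_skolem_J SkSig_skolem_J skolem_tau_hom \<phi>_skolem_tau
    by (intro exI[of _ skolem_J]) (simp add: skolem_J_def j_def T_def Let_def)
qed

end
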